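(* If $\alpha=1$ or if there are no intermediate layers ($\lambda=0$), then FLaMECaST (computing a valid layout of minimum cost, or deciding that none exists) is solvable in $O((c_0\cdot|T|)^3)$ time, where $|T|$ is the number of sinks and $c_0$ is the sink capacity.
   Context: FLaMECaST: an instance $I=(S,T,C,\alpha)$ consists of a finite set $S$ of sources and a finite set $T$ of sinks, each with a fixed position in $\mathbb{R}^2$ (several sources may share a position), capacities $C=(c_0,\dots,c_{\lambda+1})$ with integers $c_0\ge c_1\ge\dots\ge c_{\lambda+1}\ge 1$ ($\lambda\ge 0$ is the number of intermediate layers), and a parameter $\alpha\in[0,1]$. A topology is a rooted forest (edges directed from child to parent) of height at most $\lambda+1$ whose leaves are exactly $S$ and whose roots form a subset of $T$; its other vertices are Steiner vertices. The layer of a vertex is the number of edges on its path to its root. The load $\ell(v)$ of a vertex is the number of sources in its subtree; the load of an edge $uv$ ($u$ child of $v$) is $\ell(u)$. A topology is valid if $\ell(v)\le c_i$ for every vertex $v$ in layer $i$. An embedding maps each vertex to a point of $\mathbb{R}^2$, sources and sinks to their given positions and Steiner vertices arbitrarily; a topology with an embedding is a layout (valid if its topology is valid). The cost of an edge $uv$ is $\|\mathrm{pos}(u)-\mathrm{pos}(v)\|\cdot\ell(uv)^\alpha$ and the cost of a layout is the sum of its edge costs. The goal is a valid layout of minimum cost. *)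

theory Defs
  imports "HOL-Analysis.Analysis" "HOL-Library.Landau_Symbols"
begin

section \<open>FLaMECaST\<close>

text \<open>
  Sources and sinks are identified with their indices in the two position lists, so several
  of them may share a position. The list \<open>capacities\<close> is \<open>[c\<^sub>0, \<dots>, c\<^sub>\<lambda>\<^sub>+\<^sub>1]\<close>.
\<close>

record flamecast =
  source_pos :: "(real^2) list"
  sink_pos :: "(real^2) list"
  capacities :: "nat list"
  exponent :: real

definition num_sources :: "flamecast \<Rightarrow> nat" where
  "num_sources I = length (source_pos I)"

definition num_sinks :: "flamecast \<Rightarrow> nat" where
  "num_sinks I = length (sink_pos I)"

definition cap :: "flamecast \<Rightarrow> nat \<Rightarrow> nat" where
  "cap I i = capacities I ! i"

definition num_layers :: "flamecast \<Rightarrow> nat" where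
  "num_layers I = length (capacities I) - 2"

definition flamecast_instance :: "flamecast \<Rightarrow> bool" where
  "flamecast_instance I \<longleftrightarrow>
     length (capacities I) \<ge> 2 \<and>
     sorted_wrt (\<ge>) (capacities I) \<and>
     (\<forall>c \<in> set (capacities I). c \<ge> 1) \<and>
     0 \<le> exponent I \<and> exponent I \<le> 1"

datatype vertex = Source nat | Sink nat | Steiner nat

text \<open>An edge \<open>(u, v)\<close> is directed from the child \<open>u\<close> to its parent \<open>v\<close>.\<close>

record topology =
  verts :: "vertex set"
  edges :: "(vertex \<times> vertex) set"

definition rooted_forest :: "topology \<Rightarrow> bool" where
  "rooted_forest G \<longleftrightarrow>
     finite (verts G) \<and> edges G \<subseteq> verts G \<times> verts G \<and>
     single_valued (edges G) \<and> acyclic (edges G)"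

definition roots :: "topology \<Rightarrow> vertex set" where
  "roots G = verts G - Domain (edges G)"

definition leaves :: "topology \<Rightarrow> vertex set" where
  "leaves G = verts G - Range (edges G)"

definition layer :: "topology \<Rightarrow> vertex \<Rightarrow> nat" where
  "layer G v = (THE k. \<exists>r \<in> roots G. (v, r) \<in> edges G ^^ k)"

definition load :: "topology \<Rightarrow> vertex \<Rightarrow> nat" where
  "load G v = card {i. Source i \<in> verts G \<and> (Source i, v) \<in> (edges G)\<^sup>*}"

definition topology_for :: "flamecast \<Rightarrow> topology \<Rightarrow> bool" where
  "topology_for I G \<longleftrightarrow>
     rooted_forest G \<and>
     (\<forall>v \<in> verts G. layer G v \<le> num_layers I + 1) \<and>
     leaves G = Source ` {..<num_sources I} \<and>
     roots G \<subseteq> Sink ` {..<num_sinks I} \<and>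
     verts G - leaves G - roots G \<subseteq> range Steiner"

definition valid_topology :: "flamecast \<Rightarrow> topology \<Rightarrow> bool" where
  "valid_topology I G \<longleftrightarrow>
     topology_for I G \<and> (\<forall>v \<in> verts G. load G v \<le> cap I (layer G v))"

definition embedding_for :: "flamecast \<Rightarrow> topology \<Rightarrow> (vertex \<Rightarrow> real^2) \<Rightarrow> bool" where
  "embedding_for I G pos \<longleftrightarrow>
     (\<forall>i. Source i \<in> verts G \<longrightarrow> pos (Source i) = source_pos I ! i) \<and>
     (\<forall>j. Sink j \<in> verts G \<longrightarrow> pos (Sink j) = sink_pos I ! j)"

type_synonym layout = "topology \<times> (vertex \<Rightarrow> real^2)"

definition valid_layout :: "flamecast \<Rightarrow> layout \<Rightarrow> bool" where
  "valid_layout I L \<longleftrightarrow> valid_topology I (fst L) \<and> embedding_for I (fst L) (snd L)"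

definition layout_cost :: "flamecast \<Rightarrow> layout \<Rightarrow> real" where
  "layout_cost I L =
     (\<Sum>(u, v) \<in> edges (fst L).
        norm (snd L u - snd L v) * real (load (fst L) u) powr exponent I)"

definition min_cost_layout :: "flamecast \<Rightarrow> layout \<Rightarrow> bool" where
  "min_cost_layout I L \<longleftrightarrow>
     valid_layout I L \<and> (\<forall>L'. valid_layout I L' \<longrightarrow> layout_cost I L \<le> layout_cost I L')"

section \<open>Real random access machine\<close>

text \<open>
  Programs are structured real-RAM programs. Memory consists of named, unbounded arrays of
  natural numbers and of reals (a program mentions only finitely many names; a register is
  cell 0 of an array). Every elementary operation costs one unit: on reals these are the four
  arithmetic operations, square root and comparison; on naturals only addition, truncated
  subtraction and comparison, so unit cost does not permit repeated squaring of integers.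
  There is no rounding, hence no flow of data from reals to naturals except through comparisons.
\<close>

record state =
  nmem :: "string \<Rightarrow> nat \<Rightarrow> nat"
  rmem :: "string \<Rightarrow> nat \<Rightarrow> real"

datatype nexp =
    NConst nat
  | NCell string nexp
  | NAdd nexp nexp
  | NSub nexp nexp

datatype rexp =
    RConst int
  | RCell string nexp
  | RAdd rexp rexp
  | RSub rexp rexp
  | RMul rexp rexp
  | RDiv rexp rexp
  | RSqrt rexp

datatype bexp =
    NLess nexp nexp
  | RLess rexp rexp
  | BNot bexp
  | BAnd bexp bexp

datatype com =
    Skip
  | NAssign string nexp nexp
  | RAssign string nexp rexp
  | Seq com com
  | Cond bexp com com
  | While bexp com

primrec nval :: "nexp \<Rightarrow> state \<Rightarrow> nat" where
  "nval (NConst k) s = k"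
| "nval (NCell x a) s = nmem s x (nval a s)"
| "nval (NAdd a b) s = nval a s + nval b s"
| "nval (NSub a b) s = nval a s - nval b s"

primrec rval :: "rexp \<Rightarrow> state \<Rightarrow> real" where
  "rval (RConst k) s = of_int k"
| "rval (RCell x a) s = rmem s x (nval a s)"
| "rval (RAdd a b) s = rval a s + rval b s"
| "rval (RSub a b) s = rval a s - rval b s"
| "rval (RMul a b) s = rval a s * rval b s"
| "rval (RDiv a b) s = rval a s / rval b s"
| "rval (RSqrt a) s = sqrt (rval a s)"

primrec bval :: "bexp \<Rightarrow> state \<Rightarrow> bool" where
  "bval (NLess a b) s \<longleftrightarrow> nval a s < nval b s"
| "bval (RLess a b) s \<longleftrightarrow> rval a s < rval b s"
| "bval (BNot b) s \<longleftrightarrow> \<not> bval b s"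
| "bval (BAnd a b) s \<longleftrightarrow> bval a s \<and> bval b s"

primrec ntime :: "nexp \<Rightarrow> nat" where
  "ntime (NConst k) = 1"
| "ntime (NCell x a) = ntime a + 1"
| "ntime (NAdd a b) = ntime a + ntime b + 1"
| "ntime (NSub a b) = ntime a + ntime b + 1"

primrec rtime :: "rexp \<Rightarrow> nat" where
  "rtime (RConst k) = 1"
| "rtime (RCell x a) = ntime a + 1"
| "rtime (RAdd a b) = rtime a + rtime b + 1"
| "rtime (RSub a b) = rtime a + rtime b + 1"
| "rtime (RMul a b) = rtime a + rtime b + 1"
| "rtime (RDiv a b) = rtime a + rtime b + 1"
| "rtime (RSqrt a) = rtime a + 1"

primrec btime :: "bexp \<Rightarrow> nat" where
  "btime (NLess a b) = ntime a + ntime b + 1"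
| "btime (RLess a b) = rtime a + rtime b + 1"
| "btime (BNot b) = btime b + 1"
| "btime (BAnd a b) = btime a + btime b + 1"

definition nupdate :: "string \<Rightarrow> nat \<Rightarrow> nat \<Rightarrow> state \<Rightarrow> state" where
  "nupdate x i k s = s\<lparr>nmem := (nmem s)(x := (nmem s x)(i := k))\<rparr>"

definition rupdate :: "string \<Rightarrow> nat \<Rightarrow> real \<Rightarrow> state \<Rightarrow> state" where
  "rupdate x i r s = s\<lparr>rmem := (rmem s)(x := (rmem s x)(i := r))\<rparr>"

text \<open>\<open>runs c s t s'\<close>: started in \<open>s\<close>, the program \<open>c\<close> halts in \<open>s'\<close> after \<open>t\<close> steps.\<close>

inductive runs :: "com \<Rightarrow> state \<Rightarrow> nat \<Rightarrow> state \<Rightarrow> bool" where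
  Skip: "runs Skip s 1 s"
| NAssign: "runs (NAssign x a e) s (ntime a + ntime e + 1)
     (nupdate x (nval a s) (nval e s) s)"
| RAssign: "runs (RAssign x a e) s (ntime a + rtime e + 1)
     (rupdate x (nval a s) (rval e s) s)"
| Seq: "runs c1 s t1 s1 \<Longrightarrow> runs c2 s1 t2 s2 \<Longrightarrow> runs (Seq c1 c2) s (t1 + t2) s2"
| CondTrue: "bval b s \<Longrightarrow> runs c1 s t s' \<Longrightarrow> runs (Cond b c1 c2) s (btime b + t + 1) s'"
| CondFalse: "\<not> bval b s \<Longrightarrow> runs c2 s t s' \<Longrightarrow> runs (Cond b c1 c2) s (btime b + t + 1) s'"
| WhileFalse: "\<not> bval b s \<Longrightarrow> runs (While b c) s (btime b + 1) s"
| WhileTrue: "bval b s \<Longrightarrow> runs c s t1 s1 \<Longrightarrow> runs (While b c) s1 t2 s2 \<Longrightarrow>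
     runs (While b c) s (btime b + t1 + t2 + 1) s2"

lemma runs_deterministic:
  "runs c s t s' \<Longrightarrow> runs c s u s'' \<Longrightarrow> u = t \<and> s'' = s'"
proof (induction arbitrary: u s'' rule: runs.induct)
  case (WhileTrue b s c t1 s1 t2 s2)
  from WhileTrue.prems WhileTrue.hyps show ?case
    by (cases rule: runs.cases) (auto dest: WhileTrue.IH)
next
  case (Seq c1 s t1 s1 c2 t2 s2)
  from Seq.prems show ?case
    by (cases rule: runs.cases) (auto dest: Seq.IH)
qed (erule runs.cases; force)+

section \<open>Solving FLaMECaST on the real RAM\<close>

text \<open>The instance is in memory when the program starts; all other cells are 0.\<close>

definition nat_array :: "nat list \<Rightarrow> nat \<Rightarrow> nat" where
  "nat_array xs i = (if i < length xs then xs ! i else 0)"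

definition real_array :: "real list \<Rightarrow> nat \<Rightarrow> real" where
  "real_array xs i = (if i < length xs then xs ! i else 0)"

definition input_state :: "flamecast \<Rightarrow> state" where
  "input_state I =
     \<lparr>nmem = (\<lambda>_ _. 0)
        (''num_sources'' := nat_array [num_sources I],
         ''num_sinks'' := nat_array [num_sinks I],
         ''num_layers'' := nat_array [num_layers I],
         ''capacities'' := nat_array (capacities I)),
      rmem = (\<lambda>_ _. 0)
        (''source_x'' := real_array (map (\<lambda>p. p $ 1) (source_pos I)),
         ''source_y'' := real_array (map (\<lambda>p. p $ 2) (source_pos I)),
         ''sink_x'' := real_array (map (\<lambda>p. p $ 1) (sink_pos I)),
         ''sink_y'' := real_array (map (\<lambda>p. p $ 2) (sink_pos I)),
         ''exponent'' := real_array [exponent I])\<rparr>"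

text \<open>
  A layout with \<open>k\<close> Steiner vertices is output as \<open>k\<close>, the parents of the \<open>n\<close> sources (cells
  \<open>0, \<dots>, n - 1\<close> of array \<open>parent\<close>) and of the Steiner vertices (cells \<open>n, \<dots>, n + k - 1\<close>), and the
  coordinates of the Steiner vertices. A parent is coded by \<open>j\<close> if it is the \<open>j\<close>-th sink and by
  \<open>num_sinks + q\<close> if it is the \<open>q\<close>-th Steiner vertex. A topology has no isolated vertices (these
  would be both sources and sinks), so its vertex set is the field of its edge relation.
\<close>

definition output_parent :: "flamecast \<Rightarrow> state \<Rightarrow> nat \<Rightarrow> vertex" where
  "output_parent I s i =
     (let p = nmem s ''parent'' i
      in if p < num_sinks I then Sink p else Steiner (p - num_sinks I))"

definition output_edges :: "flamecast \<Rightarrow> state \<Rightarrow> (vertex \<times> vertex) set" where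
  "output_edges I s =
     {(Source i, output_parent I s i) | i. i < num_sources I} \<union>
     {(Steiner q, output_parent I s (num_sources I + q)) | q. q < nmem s ''num_steiner'' 0}"

definition output_pos :: "flamecast \<Rightarrow> state \<Rightarrow> vertex \<Rightarrow> real^2" where
  "output_pos I s v =
     (case v of
        Source i \<Rightarrow> source_pos I ! i
      | Sink j \<Rightarrow> sink_pos I ! j
      | Steiner q \<Rightarrow> vector [rmem s ''steiner_x'' q, rmem s ''steiner_y'' q])"

definition output_layout :: "flamecast \<Rightarrow> state \<Rightarrow> layout" where
  "output_layout I s =
     (\<lparr>verts = Field (output_edges I s), edges = output_edges I s\<rparr>, output_pos I s)"

definition correct_output :: "flamecast \<Rightarrow> state \<Rightarrow> bool" where
  "correct_output I s \<longleftrightarrow>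
     (if \<exists>L. valid_layout I L
      then nmem s ''feasible'' 0 = 1 \<and> min_cost_layout I (output_layout I s)
      else nmem s ''feasible'' 0 = 0)"

end

theory Submission
  imports Defs
begin

text \<open>
  Connecting every source directly to a sink is always optimal. For exponent 1 the cost of a
  layout is the total length of the source-to-root paths, which by the triangle inequality is at
  least the total distance between the sources and their roots. Without intermediate layers every
  edge has load 1, so that the exponent does not matter. What remains is the assignment problem
  between the sources and \<open>c\<^sub>0\<close> slots for each sink. It is solved by the Hungarian method: rows
  are inserted one at a time, each along a shortest augmenting path found in quadratic time by
  Dijkstra's algorithm on the reduced costs. Optimality follows from linear programming duality.
\<close>

section \<open>Time-bounded total correctness\<close>

lemma nmem_nupdate [simp]: "nmem (nupdate x i k s) = (nmem s)(x := (nmem s x)(i := k))"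
  by (simp add: nupdate_def)

lemma rmem_nupdate [simp]: "rmem (nupdate x i k s) = rmem s"
  by (simp add: nupdate_def)

lemma nmem_rupdate [simp]: "nmem (rupdate x i r s) = nmem s"
  by (simp add: rupdate_def)

lemma rmem_rupdate [simp]: "rmem (rupdate x i r s) = (rmem s)(x := (rmem s x)(i := r))"
  by (simp add: rupdate_def)

primrec nwrites :: "com \<Rightarrow> string set" where
  "nwrites Skip = {}"
| "nwrites (NAssign x a e) = {x}"
| "nwrites (RAssign x a e) = {}"
| "nwrites (Seq c1 c2) = nwrites c1 \<union> nwrites c2"
| "nwrites (Cond b c1 c2) = nwrites c1 \<union> nwrites c2"
| "nwrites (While b c) = nwrites c"

primrec rwrites :: "com \<Rightarrow> string set" where
  "rwrites Skip = {}"
| "rwrites (NAssign x a e) = {}"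
| "rwrites (RAssign x a e) = {x}"
| "rwrites (Seq c1 c2) = rwrites c1 \<union> rwrites c2"
| "rwrites (Cond b c1 c2) = rwrites c1 \<union> rwrites c2"
| "rwrites (While b c) = rwrites c"

definition frame :: "com \<Rightarrow> state \<Rightarrow> state \<Rightarrow> bool" where
  "frame c s s' \<longleftrightarrow>
     (\<forall>x. x \<notin> nwrites c \<longrightarrow> nmem s' x = nmem s x) \<and> (\<forall>x. x \<notin> rwrites c \<longrightarrow> rmem s' x = rmem s x)"

lemma frame_refl: "frame c s s"
  by (simp add: frame_def)

lemma frame_trans: "frame c s s' \<Longrightarrow> frame c s' s'' \<Longrightarrow> frame c s s''"
  by (simp add: frame_def)

lemma frame_nmem: "frame c s s' \<Longrightarrow> x \<notin> nwrites c \<Longrightarrow> nmem s' x = nmem s x"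
  by (simp add: frame_def)

lemma runs_frame: "runs c s t s' \<Longrightarrow> frame c s s'"
  by (induction rule: runs.induct) (auto simp: frame_def)

primrec nexp_arrays :: "nexp \<Rightarrow> string set" where
  "nexp_arrays (NConst k) = {}"
| "nexp_arrays (NCell x a) = insert x (nexp_arrays a)"
| "nexp_arrays (NAdd a b) = nexp_arrays a \<union> nexp_arrays b"
| "nexp_arrays (NSub a b) = nexp_arrays a \<union> nexp_arrays b"

lemma frame_nval: "frame c s s' \<Longrightarrow> nexp_arrays e \<inter> nwrites c = {} \<Longrightarrow> nval e s' = nval e s"
  by (induction e) (auto simp: frame_def Int_Un_distrib2)

definition halts_within :: "nat \<Rightarrow> com \<Rightarrow> state \<Rightarrow> (state \<Rightarrow> bool) \<Rightarrow> bool" where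
  "halts_within T c s Q \<longleftrightarrow> (\<exists>t s'. runs c s t s' \<and> t \<le> T \<and> Q s')"

lemma halts_within_mono:
  assumes "halts_within T c s Q" "T \<le> T'" "\<And>s'. frame c s s' \<Longrightarrow> Q s' \<Longrightarrow> Q' s'"
  shows "halts_within T' c s Q'"
  using assms unfolding halts_within_def by (meson le_trans runs_frame)

lemma halts_within_Seq:
  assumes first: "halts_within T1 c1 s P"
    and second: "\<And>s'. frame c1 s s' \<Longrightarrow> P s' \<Longrightarrow> halts_within T2 c2 s' Q"
  shows "halts_within (T1 + T2) (Seq c1 c2) s Q"
proof -
  obtain t1 s1 where run1: "runs c1 s t1 s1" "t1 \<le> T1" "P s1"
    using first by (auto simp: halts_within_def)
  obtain t2 s2 where run2: "runs c2 s1 t2 s2" "t2 \<le> T2" "Q s2"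
    using second[OF runs_frame[OF run1(1)] run1(3)] by (auto simp: halts_within_def)
  show ?thesis
    unfolding halts_within_def using runs.Seq[OF run1(1) run2(1)] run1 run2 by (metis add_mono)
qed

lemma halts_within_Cond:
  assumes "bval b s \<Longrightarrow> halts_within T c1 s Q" "\<not> bval b s \<Longrightarrow> halts_within T c2 s Q"
  shows "halts_within (btime b + T + 1) (Cond b c1 c2) s Q"
proof (cases "bval b s")
  case True
  then show ?thesis
    using assms(1) runs.CondTrue[OF True] unfolding halts_within_def
    by (meson add_le_mono le_refl)
next
  case False
  then show ?thesis
    using assms(2) runs.CondFalse[OF False] unfolding halts_within_def
    by (meson add_le_mono le_refl)
qed

lemma halts_within_While:
  assumes init: "Inv k s"
    and step: "\<And>i s'. \<lbrakk>Inv i s'; frame c s s'; bval b s'\<rbrakk>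
      \<Longrightarrow> halts_within B c s' (\<lambda>s''. \<exists>j<i. Inv j s'')"
  shows "halts_within (k * (B + btime b + 1) + btime b + 1) (While b c) s
           (\<lambda>s'. (\<exists>i. Inv i s') \<and> \<not> bval b s')"
proof -
  let ?T = "\<lambda>k. k * (B + btime b + 1) + btime b + 1"
  have "halts_within (?T i) (While b c) s' (\<lambda>s'. (\<exists>i. Inv i s') \<and> \<not> bval b s')"
    if "Inv i s'" "frame c s s'" for i s'
    using that
  proof (induction i arbitrary: s' rule: less_induct)
    case (less i)
    show ?case
    proof (cases "bval b s'")
      case True
      obtain t1 s1 j where body: "runs c s' t1 s1" "t1 \<le> B" "j < i" "Inv j s1"
        using step[OF less.prems True] by (auto simp: halts_within_def)
      obtain t2 s2 where rest: "runs (While b c) s1 t2 s2" "t2 \<le> ?T j"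
          "(\<exists>i. Inv i s2) \<and> \<not> bval b s2"
        using less.IH[OF body(3,4) frame_trans[OF less.prems(2) runs_frame[OF body(1)]]]
        by (auto simp: halts_within_def)
      have "Suc j * (B + btime b + 1) \<le> i * (B + btime b + 1)"
        using body(3) by (intro mult_right_mono) auto
      then have "btime b + t1 + t2 + 1 \<le> ?T i"
        using body(2) rest(2) by simp
      then show ?thesis
        unfolding halts_within_def using runs.WhileTrue[OF True body(1) rest(1)] rest(3) by blast
    next
      case False
      then show ?thesis
        unfolding halts_within_def using runs.WhileFalse[OF False, of c] less.prems(1)
        by (intro exI[of _ "btime b + 1"] exI[of _ s']) auto
    qed
  qed
  then show ?thesis
    using init frame_refl by blast
qed

primrec loop_free :: "com \<Rightarrow> bool" where
  "loop_free Skip \<longleftrightarrow> True"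
| "loop_free (NAssign x a e) \<longleftrightarrow> True"
| "loop_free (RAssign x a e) \<longleftrightarrow> True"
| "loop_free (Seq c1 c2) \<longleftrightarrow> loop_free c1 \<and> loop_free c2"
| "loop_free (Cond b c1 c2) \<longleftrightarrow> loop_free c1 \<and> loop_free c2"
| "loop_free (While b c) \<longleftrightarrow> False"

text \<open>The values of \<open>exec\<close> and \<open>exec_time\<close> on \<open>While\<close> are junk.\<close>

primrec exec :: "com \<Rightarrow> state \<Rightarrow> state" where
  "exec Skip s = s"
| "exec (NAssign x a e) s = nupdate x (nval a s) (nval e s) s"
| "exec (RAssign x a e) s = rupdate x (nval a s) (rval e s) s"
| "exec (Seq c1 c2) s = exec c2 (exec c1 s)"
| "exec (Cond b c1 c2) s = (if bval b s then exec c1 s else exec c2 s)"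
| "exec (While b c) s = s"

primrec exec_time :: "com \<Rightarrow> nat" where
  "exec_time Skip = 1"
| "exec_time (NAssign x a e) = ntime a + ntime e + 1"
| "exec_time (RAssign x a e) = ntime a + rtime e + 1"
| "exec_time (Seq c1 c2) = exec_time c1 + exec_time c2"
| "exec_time (Cond b c1 c2) = btime b + max (exec_time c1) (exec_time c2) + 1"
| "exec_time (While b c) = 0"

lemma halts_within_exec_time: "loop_free c \<Longrightarrow> halts_within (exec_time c) c s (\<lambda>s'. s' = exec c s)"
proof (induction c arbitrary: s)
  case Skip
  show ?case
    using runs.Skip by (fastforce simp: halts_within_def)
next
  case (NAssign x a e)
  show ?case
    using runs.NAssign by (fastforce simp: halts_within_def)
next
  case (RAssign x a e)
  show ?case
    using runs.RAssign by (fastforce simp: halts_within_def)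
next
  case (Seq c1 c2)
  then show ?case
    by (auto intro: halts_within_Seq)
next
  case (Cond b c1 c2)
  let ?T = "max (exec_time c1) (exec_time c2)"
  have "halts_within ?T c1 s (\<lambda>s'. s' = exec c1 s)" "halts_within ?T c2 s (\<lambda>s'. s' = exec c2 s)"
    using Cond
    by (auto intro: halts_within_mono[OF _ max.cobounded1] halts_within_mono[OF _ max.cobounded2])
  then have "halts_within (btime b + ?T + 1) (Cond b c1 c2) s (\<lambda>s'. s' = exec (Cond b c1 c2) s)"
    by (intro halts_within_Cond) simp_all
  then show ?case
    by simp
qed simp

lemma halts_within_exec:
  assumes "loop_free c" "exec_time c \<le> T" "Q (exec c s)"
  shows "halts_within T c s Q"
  by (rule halts_within_mono[OF halts_within_exec_time]) (use assms in auto)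

abbreviation nreg :: "string \<Rightarrow> nexp" where "nreg x \<equiv> NCell x (NConst 0)"
abbreviation rreg :: "string \<Rightarrow> rexp" where "rreg x \<equiv> RCell x (NConst 0)"
abbreviation nset :: "string \<Rightarrow> nexp \<Rightarrow> com" where "nset x \<equiv> NAssign x (NConst 0)"
abbreviation rset :: "string \<Rightarrow> rexp \<Rightarrow> com" where "rset x \<equiv> RAssign x (NConst 0)"
abbreviation ninc :: "string \<Rightarrow> com" where "ninc x \<equiv> nset x (NAdd (nreg x) (NConst 1))"
abbreviation BOr :: "bexp \<Rightarrow> bexp \<Rightarrow> bexp" where
  "BOr a b \<equiv> BNot (BAnd (BNot a) (BNot b))"
abbreviation seq_op (infixr ";;" 60) where "c1 ;; c2 \<equiv> Seq c1 c2"

definition for_range :: "string \<Rightarrow> nat \<Rightarrow> nexp \<Rightarrow> com \<Rightarrow> com" where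
  "for_range x a b c = (nset x (NConst a) ;; While (NLess (nreg x) b) (c ;; ninc x))"

lemma writes_for_range [simp]:
  "nwrites (for_range x a b c) = insert x (nwrites c)"
  "rwrites (for_range x a b c) = rwrites c"
  by (auto simp: for_range_def)

lemma halts_within_iteration:
  assumes fresh: "x \<notin> nwrites c" and counter_free: "\<And>k l s'. Inv k (nupdate x 0 l s') = Inv k s'"
    and body: "halts_within B c s (Inv (Suc (nmem s x 0)))"
  shows "halts_within (B + 6) (c ;; ninc x) s
    (\<lambda>s'. nmem s' x 0 = Suc (nmem s x 0) \<and> Inv (nmem s' x 0) s')"
proof (rule halts_within_Seq[OF body])
  fix s' assume "frame c s s'" "Inv (Suc (nmem s x 0)) s'"
  moreover from this have "nmem s' x = nmem s x"
    using fresh by (simp add: frame_nmem)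
  ultimately show "halts_within 6 (ninc x) s'
      (\<lambda>s'. nmem s' x 0 = Suc (nmem s x 0) \<and> Inv (nmem s' x 0) s')"
    by (intro halts_within_exec) (simp_all add: counter_free)
qed

lemma halts_within_count_up:
  assumes fresh: "x \<notin> nwrites c" "nexp_arrays b \<inter> insert x (nwrites c) = {}"
    and counter_free: "\<And>k l s'. Inv k (nupdate x 0 l s') = Inv k s'"
    and init: "nval b s = m" "nmem s x 0 = a" "a \<le> m" "Inv a s"
    and step: "\<And>k s'. \<lbrakk>a \<le> k; k < m; nmem s' x 0 = k; Inv k s'; frame (c ;; ninc x) s s'\<rbrakk>
      \<Longrightarrow> halts_within B c s' (Inv (Suc k))"
  shows "halts_within ((m - a) * (B + ntime b + 10) + ntime b + 4)
    (While (NLess (nreg x) b) (c ;; ninc x)) s (Inv m)"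
proof -
  let ?body = "c ;; ninc x" and ?test = "NLess (nreg x) b"
  let ?J = "\<lambda>i s'. a \<le> nmem s' x 0 \<and> nmem s' x 0 + i = m \<and> Inv (nmem s' x 0) s'"
  have bound: "nval b s' = m" if "frame ?body s s'" for s'
    using frame_nval[OF that] fresh(2) init(1) by simp
  have iteration: "halts_within (B + 6) ?body s' (\<lambda>s''. \<exists>j<i. ?J j s'')"
    if J: "?J i s'" and frame: "frame ?body s s'" and test: "bval ?test s'" for i s'
  proof -
    have less: "nmem s' x 0 < m"
      using test bound[OF frame] by simp
    then have "halts_within B c s' (Inv (Suc (nmem s' x 0)))"
      using J by (intro step[OF _ _ _ _ frame]) auto
    then show ?thesis
    proof (rule halts_within_mono[OF halts_within_iteration[OF fresh(1) counter_free] order_refl])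
      fix s'' assume "nmem s'' x 0 = Suc (nmem s' x 0) \<and> Inv (nmem s'' x 0) s''"
      then show "\<exists>j<i. ?J j s''"
        using J less by (intro exI[of _ "i - 1"]) auto
    qed
  qed
  have "?J (m - a) s"
    using init by simp
  then have "halts_within ((m - a) * ((B + 6) + btime ?test + 1) + btime ?test + 1)
      (While ?test ?body) s (\<lambda>s'. (\<exists>i. ?J i s') \<and> \<not> bval ?test s')"
    using iteration by (rule halts_within_While)
  then show ?thesis
  proof (rule halts_within_mono)
    fix s' assume "frame (While ?test ?body) s s'" and exit: "(\<exists>i. ?J i s') \<and> \<not> bval ?test s'"
    then have "nmem s' x 0 = m"
      using bound[of s'] by (auto simp: frame_def)
    then show "Inv m s'"
      using exit by auto
  qed (simp add: algebra_simps)
qed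

lemma halts_within_for_range:
  assumes fresh: "x \<notin> nwrites c" "nexp_arrays b \<inter> insert x (nwrites c) = {}"
    and counter_free: "\<And>k l s'. Inv k (nupdate x 0 l s') = Inv k s'"
    and init: "nval b s = m" "a \<le> m" "Inv a s"
    and step: "\<And>k s'. \<lbrakk>a \<le> k; k < m; nmem s' x 0 = k; Inv k s'; frame (for_range x a b c) s s'\<rbrakk>
      \<Longrightarrow> halts_within B c s' (Inv (Suc k))"
  shows "halts_within ((m - a) * (B + ntime b + 10) + ntime b + 7) (for_range x a b c) s (Inv m)"
proof -
  let ?init = "nset x (NConst a)"
  have "halts_within (3 + ((m - a) * (B + ntime b + 10) + ntime b + 4)) (for_range x a b c) s
      (Inv m)"
    unfolding for_range_def
  proof (rule halts_within_Seq)
    show "halts_within 3 ?init s (\<lambda>s'. s' = exec ?init s)"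
      by (rule halts_within_exec) simp_all
  next
    fix s1 assume frame1: "frame ?init s s1" and s1: "s1 = exec ?init s"
    show "halts_within ((m - a) * (B + ntime b + 10) + ntime b + 4)
        (While (NLess (nreg x) b) (c ;; ninc x)) s1 (Inv m)"
    proof (rule halts_within_count_up[OF fresh counter_free])
      show "nval b s1 = m"
        using frame_nval[OF frame1] fresh(2) init(1) by simp
    next
      fix k s' assume "a \<le> k" "k < m" "nmem s' x 0 = k" "Inv k s'" "frame (c ;; ninc x) s1 s'"
      then show "halts_within B c s' (Inv (Suc k))"
        using frame1 by (intro step) (simp_all add: frame_def)
    qed (use s1 init counter_free in simp_all)
  qed
  then show ?thesis
    by (rule halts_within_mono) simp_all
qed

lemma halts_within_for_range_exec:
  assumes "loop_free c" and "x \<notin> nwrites c" "nexp_arrays b \<inter> insert x (nwrites c) = {}"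
    and "\<And>k l s'. Inv k (nupdate x 0 l s') = Inv k s'" and "nval b s = m" "a \<le> m" "Inv a s"
    and "\<And>k s'. \<lbrakk>a \<le> k; k < m; nmem s' x 0 = k; Inv k s'; frame (for_range x a b c) s s'\<rbrakk>
      \<Longrightarrow> Inv (Suc k) (exec c s')"
    and time: "(m - a) * (exec_time c + ntime b + 10) + ntime b + 7 \<le> T"
  shows "halts_within T (for_range x a b c) s (Inv m)"
  by (rule halts_within_mono[OF halts_within_for_range time])
    (use assms in \<open>auto intro: halts_within_exec\<close>)

section \<open>Direct layouts\<close>

lemma relpow_to_sink_unique:
  assumes "single_valued E" "(v, r) \<in> E ^^ k" "(v, r') \<in> E ^^ l"
    and "r \<notin> Domain E" "r' \<notin> Domain E"
  shows "k = l"
  using assms(2,3)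
proof (induction k arbitrary: v l)
  case 0
  then show ?case
    using assms(4) by (cases l) (use relpow_Suc_D2 in fastforce)+
next
  case (Suc k)
  obtain y where y: "(v, y) \<in> E" "(y, r) \<in> E ^^ k"
    using Suc.prems(1) relpow_Suc_D2 by metis
  show ?case
  proof (cases l)
    case 0
    then show ?thesis
      using Suc.prems(2) y(1) assms(5) by auto
  next
    case (Suc l')
    then obtain y' where y': "(v, y') \<in> E" "(y', r') \<in> E ^^ l'"
      using Suc.prems(2) relpow_Suc_D2 by metis
    then have "y' = y"
      using y(1) assms(1) by (auto dest: single_valuedD)
    then show ?thesis
      using Suc y' Suc.IH[OF y(2)] by auto
  qed
qed

lemma layer_eqI:
  assumes "rooted_forest G" "r \<in> roots G" "(v, r) \<in> edges G ^^ k"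
  shows "layer G v = k"
  unfolding layer_def
proof (rule the_equality)
  show "\<exists>r \<in> roots G. (v, r) \<in> edges G ^^ k"
    using assms by auto
next
  fix l assume "\<exists>r \<in> roots G. (v, r) \<in> edges G ^^ l"
  then show "l = k"
    using relpow_to_sink_unique[of "edges G" v _ l r k] assms
    by (auto simp: rooted_forest_def roots_def)
qed

lemma rooted_forest_finite_edges: "rooted_forest G \<Longrightarrow> finite (edges G)"
  by (auto simp: rooted_forest_def intro: finite_subset)

lemma rooted_forest_reaches_root:
  assumes "rooted_forest G" "v \<in> verts G"
  shows "\<exists>r \<in> roots G. (v, r) \<in> (edges G)\<^sup>*"
proof -
  have "wf ((edges G)\<inverse>)"
    using assms(1) rooted_forest_finite_edges
    by (auto simp: rooted_forest_def intro: finite_acyclic_wf_converse)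
  then show ?thesis
    using assms(2)
  proof (induction v rule: wf_induct_rule)
    case (less v)
    show ?case
    proof (cases "v \<in> Domain (edges G)")
      case True
      then obtain y where y: "(v, y) \<in> edges G"
        by auto
      then have "y \<in> verts G"
        using assms(1) by (auto simp: rooted_forest_def)
      then obtain r where "r \<in> roots G" "(y, r) \<in> (edges G)\<^sup>*"
        using less.IH y by auto
      then show ?thesis
        using y by (auto intro: converse_rtrancl_into_rtrancl)
    next
      case False
      then show ?thesis
        using less.prems by (auto simp: roots_def)
    qed
  qed
qed

lemma layer_child:
  assumes "rooted_forest G" "(u, v) \<in> edges G"
  shows "layer G u = Suc (layer G v)"
proof -
  have "v \<in> verts G"
    using assms by (auto simp: rooted_forest_def)
  then obtain r k where "r \<in> roots G" "(v, r) \<in> edges G ^^ k"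
    using rooted_forest_reaches_root[OF assms(1)] rtrancl_imp_relpow by blast
  then show ?thesis
    using layer_eqI[OF assms(1)] relpow_Suc_I2[OF assms(2)] by metis
qed

lemma norm_diff_le_path_length:
  fixes pos :: "'v \<Rightarrow> 'a::real_normed_vector"
  assumes "(x, r) \<in> E\<^sup>*" "finite E" "acyclic E"
  shows "norm (pos x - pos r) \<le> (\<Sum>(u, v) \<in> {e \<in> E. (x, fst e) \<in> E\<^sup>*}. norm (pos u - pos v))"
  using assms(1)
proof (induction rule: converse_rtrancl_induct)
  case base
  then show ?case
    by (auto intro: sum_nonneg)
next
  case (step x y)
  let ?A = "\<lambda>z. {e \<in> E. (z, fst e) \<in> E\<^sup>*}"
  have notin: "(x, y) \<notin> ?A y"
    using step.hyps(1) assms(3) by (auto simp: acyclic_def dest: rtrancl_into_trancl2)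
  have "norm (pos x - pos r) \<le> norm (pos x - pos y) + norm (pos y - pos r)"
    using norm_triangle_ineq[of "pos x - pos y" "pos y - pos r"] by simp
  also have "\<dots> \<le> (\<Sum>(u, v) \<in> insert (x, y) (?A y). norm (pos u - pos v))"
    using step.IH notin assms(2) by simp
  also have "\<dots> \<le> (\<Sum>(u, v) \<in> ?A x. norm (pos u - pos v))"
    using step.hyps(1) assms(2)
    by (intro sum_mono2) (auto intro: converse_rtrancl_into_rtrancl)
  finally show ?case .
qed

definition num_slots :: "flamecast \<Rightarrow> nat" where
  "num_slots I = cap I 0 * num_sinks I"

definition assignment :: "flamecast \<Rightarrow> (nat \<Rightarrow> nat) \<Rightarrow> bool" where
  "assignment I f \<longleftrightarrow>
     (\<forall>i < num_sources I. f i < num_sinks I) \<and>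
     (\<forall>j. card {i. i < num_sources I \<and> f i = j} \<le> cap I 0)"

definition assignment_cost :: "flamecast \<Rightarrow> (nat \<Rightarrow> nat) \<Rightarrow> real" where
  "assignment_cost I f = (\<Sum>i < num_sources I. norm (source_pos I ! i - sink_pos I ! f i))"

definition optimal_assignment :: "flamecast \<Rightarrow> (nat \<Rightarrow> nat) \<Rightarrow> bool" where
  "optimal_assignment I f \<longleftrightarrow>
     assignment I f \<and> (\<forall>g. assignment I g \<longrightarrow> assignment_cost I f \<le> assignment_cost I g)"

subsection \<open>From layouts to assignments\<close>

locale feasible_layout =
  fixes I :: flamecast and G :: topology and pos :: "vertex \<Rightarrow> real^2"
  assumes valid: "valid_layout I (G, pos)"
begin

lemma forest: "rooted_forest G"
  and layer_le: "v \<in> verts G \<Longrightarrow> layer G v \<le> num_layers I + 1"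
  and leaves_eq: "leaves G = Source ` {..<num_sources I}"
  and roots_subset: "roots G \<subseteq> Sink ` {..<num_sinks I}"
  and inner_subset: "verts G - leaves G - roots G \<subseteq> range Steiner"
  and load_le: "v \<in> verts G \<Longrightarrow> load G v \<le> cap I (layer G v)"
  using valid by (auto simp: valid_layout_def valid_topology_def topology_for_def)

lemma finite_edges: "finite (edges G)"
  by (rule rooted_forest_finite_edges[OF forest])

lemma Source_in_verts: "Source i \<in> verts G \<longleftrightarrow> i < num_sources I"
proof
  assume "Source i \<in> verts G"
  then have "Source i \<in> leaves G \<union> roots G"
    using inner_subset by auto
  then show "i < num_sources I"
    using leaves_eq roots_subset by auto
next
  assume "i < num_sources I"
  then have "Source i \<in> leaves G"
    using leaves_eq by auto
  then show "Source i \<in> verts G"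
    by (simp add: leaves_def)
qed

lemma load_eq_card: "load G v = card {i. i < num_sources I \<and> (Source i, v) \<in> (edges G)\<^sup>*}"
  by (simp add: load_def Source_in_verts)

definition target :: "nat \<Rightarrow> nat" where
  "target i = (SOME j. Sink j \<in> roots G \<and> (Source i, Sink j) \<in> (edges G)\<^sup>*)"

lemma target:
  assumes "i < num_sources I"
  shows "Sink (target i) \<in> roots G" "(Source i, Sink (target i)) \<in> (edges G)\<^sup>*"
proof -
  have "\<exists>j. Sink j \<in> roots G \<and> (Source i, Sink j) \<in> (edges G)\<^sup>*"
    using rooted_forest_reaches_root[OF forest, of "Source i"] Source_in_verts assms roots_subset
    by blast
  then have "Sink (target i) \<in> roots G \<and> (Source i, Sink (target i)) \<in> (edges G)\<^sup>*"
    unfolding target_def by (rule someI_ex)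
  then show "Sink (target i) \<in> roots G" "(Source i, Sink (target i)) \<in> (edges G)\<^sup>*"
    by auto
qed

lemma assignment_target: "assignment I target"
  unfolding assignment_def
proof (intro conjI allI impI)
  fix i assume "i < num_sources I"
  then show "target i < num_sinks I"
    using target(1) roots_subset by auto
next
  fix j
  show "card {i. i < num_sources I \<and> target i = j} \<le> cap I 0"
  proof (cases "{i. i < num_sources I \<and> target i = j} = {}")
    case False
    then have root: "Sink j \<in> roots G"
      using target(1) by auto
    have "card {i. i < num_sources I \<and> target i = j} \<le> load G (Sink j)"
      unfolding load_eq_card using target(2) by (intro card_mono) auto
    also have "\<dots> \<le> cap I (layer G (Sink j))"
      using root by (intro load_le) (simp add: roots_def)
    also have "layer G (Sink j) = 0"
      by (rule layer_eqI[OF forest root]) simp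
    finally show ?thesis .
  qed (simp only: card.empty le0)
qed

lemma assignment_cost_target:
  "assignment_cost I target = (\<Sum>i < num_sources I. norm (pos (Source i) - pos (Sink (target i))))"
proof -
  have "pos (Source i) = source_pos I ! i \<and> pos (Sink (target i)) = sink_pos I ! target i"
    if "i < num_sources I" for i
    using valid Source_in_verts target(1)[OF that] that
    by (simp add: valid_layout_def embedding_for_def roots_def)
  then show ?thesis
    by (simp add: assignment_cost_def)
qed

text \<open>Weighting every edge by its load counts the lengths of all source-to-root paths.\<close>

lemma assignment_cost_target_le_weighted_length:
  "assignment_cost I target \<le> (\<Sum>(u, v) \<in> edges G. norm (pos u - pos v) * real (load G u))"
proof -
  let ?n = "num_sources I" and ?E = "edges G"
  let ?length = "\<lambda>e. norm (pos (fst e) - pos (snd e))"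
  let ?reach = "\<lambda>i e. (Source i, fst e) \<in> ?E\<^sup>*"
  have load: "real (load G u) = (\<Sum>i < ?n. of_bool ((Source i, u) \<in> ?E\<^sup>*))" for u
    by (simp add: load_eq_card lessThan_def Collect_conj_eq)
  have "assignment_cost I target \<le> (\<Sum>i < ?n. \<Sum>e \<in> {e \<in> ?E. ?reach i e}. ?length e)"
    unfolding assignment_cost_target
  proof (rule sum_mono)
    fix i assume "i \<in> {..<?n}"
    then show "norm (pos (Source i) - pos (Sink (target i)))
        \<le> (\<Sum>e \<in> {e \<in> ?E. ?reach i e}. ?length e)"
      using norm_diff_le_path_length[OF target(2) finite_edges, of i pos] forest
      by (simp add: rooted_forest_def case_prod_beta)
  qed
  also have "\<dots> = (\<Sum>i < ?n. \<Sum>e \<in> ?E. ?length e * of_bool (?reach i e))"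
    using finite_edges by (intro sum.cong refl sum.mono_neutral_cong_left) auto
  also have "\<dots> = (\<Sum>e \<in> ?E. \<Sum>i < ?n. ?length e * of_bool (?reach i e))"
    by (rule sum.swap)
  also have "\<dots> = (\<Sum>e \<in> ?E. ?length e * real (load G (fst e)))"
    by (simp only: load sum_distrib_left)
  finally show ?thesis
    by (simp add: case_prod_beta)
qed

lemma load_child_eq_1:
  assumes "num_layers I = 0" "(u, v) \<in> edges G"
  shows "load G u = 1"
proof -
  have verts: "x \<in> verts G" if "(x, y) \<in> edges G" for x y
    using that forest by (auto simp: rooted_forest_def)
  have no_child: "(x, u) \<notin> edges G" for x
  proof
    assume child: "(x, u) \<in> edges G"
    then have "layer G x = Suc (Suc (layer G v))"
      using layer_child[OF forest] assms(2) by simp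
    then show False
      using layer_le[OF verts[OF child]] assms(1) by simp
  qed
  then have "u \<in> leaves G"
    using verts[OF assms(2)] by (auto simp: leaves_def)
  then obtain i where "u = Source i" "i < num_sources I"
    using leaves_eq by auto
  moreover have "(x, u) \<in> (edges G)\<^sup>* \<longleftrightarrow> x = u" for x
    using no_child by (auto elim: rtranclE)
  ultimately have "{k. k < num_sources I \<and> (Source k, u) \<in> (edges G)\<^sup>*} = {i}"
    by auto
  then show ?thesis
    by (simp add: load_eq_card)
qed

lemma layout_cost_eq_weighted_length:
  assumes "exponent I = 1 \<or> num_layers I = 0"
  shows "layout_cost I (G, pos) = (\<Sum>(u, v) \<in> edges G. norm (pos u - pos v) * real (load G u))"
  using assms load_child_eq_1 by (auto simp: layout_cost_def intro!: sum.cong)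

end

lemma assignment_of_layout:
  assumes "exponent I = 1 \<or> num_layers I = 0" "valid_layout I L"
  obtains f where "assignment I f" "assignment_cost I f \<le> layout_cost I L"
proof -
  obtain G pos where L: "L = (G, pos)"
    by (cases L)
  interpret feasible_layout I G pos
    using assms(2) L by unfold_locales simp
  show thesis
    using that[OF assignment_target] assignment_cost_target_le_weighted_length
      layout_cost_eq_weighted_length[OF assms(1)] by (simp add: L)
qed

lemma assignment_num_sources_le:
  assumes "assignment I f"
  shows "num_sources I \<le> num_slots I"
proof -
  let ?fibre = "\<lambda>j. {i. i < num_sources I \<and> f i = j}"
  have "{..<num_sources I} \<subseteq> (\<Union>j < num_sinks I. ?fibre j)"
    using assms by (auto simp: assignment_def)
  then have "card {..<num_sources I} \<le> card (\<Union>j < num_sinks I. ?fibre j)"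
    by (intro card_mono) auto
  also have "\<dots> \<le> (\<Sum>j < num_sinks I. card (?fibre j))"
    by (rule card_UN_le) simp
  also have "\<dots> \<le> (\<Sum>j < num_sinks I. cap I 0)"
    using assms by (intro sum_mono) (simp add: assignment_def)
  finally show ?thesis
    by (simp add: num_slots_def mult.commute)
qed

subsection \<open>From assignments to layouts\<close>

definition direct_topology :: "nat \<Rightarrow> (nat \<Rightarrow> nat) \<Rightarrow> topology" where
  "direct_topology n f =
     \<lparr>verts = Source ` {..<n} \<union> Sink ` f ` {..<n}, edges = (\<lambda>i. (Source i, Sink (f i))) ` {..<n}\<rparr>"

lemma edges_direct_topology:
  "(x, y) \<in> edges (direct_topology n f) \<longleftrightarrow> (\<exists>i<n. x = Source i \<and> y = Sink (f i))"
  by (auto simp: direct_topology_def)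

lemma verts_direct_topology: "verts (direct_topology n f) = Source ` {..<n} \<union> Sink ` f ` {..<n}"
  by (simp add: direct_topology_def)

lemma rtrancl_edges_direct_topology:
  "(x, y) \<in> (edges (direct_topology n f))\<^sup>* \<longleftrightarrow> x = y \<or> (x, y) \<in> edges (direct_topology n f)"
proof
  assume "(x, y) \<in> (edges (direct_topology n f))\<^sup>*"
  then show "x = y \<or> (x, y) \<in> edges (direct_topology n f)"
    by (induction rule: rtrancl_induct) (auto simp: edges_direct_topology)
qed auto

lemma rooted_forest_direct_topology: "rooted_forest (direct_topology n f)"
proof -
  have "(x, x) \<notin> (edges (direct_topology n f))\<^sup>+" for x
    by (auto dest!: tranclD simp: rtrancl_edges_direct_topology edges_direct_topology)
  then have "acyclic (edges (direct_topology n f))"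
    by (simp add: acyclic_def)
  then show ?thesis
    by (auto simp: rooted_forest_def single_valued_def edges_direct_topology verts_direct_topology)
qed

lemma roots_direct_topology: "roots (direct_topology n f) = Sink ` f ` {..<n}"
  by (auto simp: roots_def verts_direct_topology Domain_iff edges_direct_topology)

lemma leaves_direct_topology: "leaves (direct_topology n f) = Source ` {..<n}"
  by (auto simp: leaves_def verts_direct_topology Range_iff edges_direct_topology)

lemma layer_direct_topology:
  assumes "i < n"
  shows "layer (direct_topology n f) (Source i) = 1" "layer (direct_topology n f) (Sink (f i)) = 0"
  by (rule layer_eqI[OF rooted_forest_direct_topology, of "Sink (f i)"],
      use assms in \<open>auto simp: roots_direct_topology edges_direct_topology\<close>)+

lemma load_direct_topology:
  "i < n \<Longrightarrow> load (direct_topology n f) (Source i) = 1"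
  "load (direct_topology n f) (Sink j) = card {i. i < n \<and> f i = j}"
proof -
  let ?G = "direct_topology n f"
  have "{k. Source k \<in> verts ?G \<and> (Source k, Source i) \<in> (edges ?G)\<^sup>*} = {i}" if "i < n"
    using that
    by (auto simp: verts_direct_topology rtrancl_edges_direct_topology edges_direct_topology)
  then show "i < n \<Longrightarrow> load ?G (Source i) = 1"
    by (simp add: load_def)
  have "{k. Source k \<in> verts ?G \<and> (Source k, Sink j) \<in> (edges ?G)\<^sup>*} = {i. i < n \<and> f i = j}"
    by (auto simp: verts_direct_topology rtrancl_edges_direct_topology edges_direct_topology)
  then show "load ?G (Sink j) = card {i. i < n \<and> f i = j}"
    by (simp add: load_def)
qed

lemma valid_direct_topology:
  assumes "flamecast_instance I" "assignment I f"
  shows "valid_topology I (direct_topology (num_sources I) f)"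
proof -
  have "cap I 1 \<ge> 1"
    using assms(1) by (auto simp: flamecast_instance_def cap_def)
  moreover have "topology_for I (direct_topology (num_sources I) f)"
    using assms(2) layer_direct_topology rooted_forest_direct_topology
    by (auto simp: topology_for_def assignment_def verts_direct_topology roots_direct_topology
        leaves_direct_topology)
  ultimately show ?thesis
    using assms(2)
    by (auto simp: valid_topology_def assignment_def verts_direct_topology layer_direct_topology
        load_direct_topology)
qed

lemma layout_cost_direct_topology:
  assumes "embedding_for I (direct_topology (num_sources I) f) pos"
  shows "layout_cost I (direct_topology (num_sources I) f, pos) = assignment_cost I f"
proof -
  let ?n = "num_sources I"
  have "layout_cost I (direct_topology ?n f, pos) =
      (\<Sum>i < ?n. norm (pos (Source i) - pos (Sink (f i)))
        * real (load (direct_topology ?n f) (Source i)) powr exponent I)"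
    by (simp add: layout_cost_def) (simp add: direct_topology_def sum.reindex inj_on_def)
  also have "\<dots> = assignment_cost I f"
    using assms
    by (simp add: assignment_cost_def load_direct_topology embedding_for_def verts_direct_topology)
  finally show ?thesis .
qed

lemma output_layout_direct:
  assumes "nmem s ''num_steiner'' 0 = 0" "assignment I (nmem s ''parent'')"
  shows "output_layout I s = (direct_topology (num_sources I) (nmem s ''parent''), output_pos I s)"
proof -
  have "output_edges I s = edges (direct_topology (num_sources I) (nmem s ''parent''))"
    using assms
    by (auto simp: output_edges_def output_parent_def assignment_def direct_topology_def)
  then show ?thesis
    by (auto simp: output_layout_def direct_topology_def Field_def)
qed

lemma min_cost_layout_output:
  assumes inst: "flamecast_instance I" "exponent I = 1 \<or> num_layers I = 0"
    and direct: "nmem s ''num_steiner'' 0 = 0" and opt: "optimal_assignment I (nmem s ''parent'')"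
  shows "min_cost_layout I (output_layout I s)"
  unfolding min_cost_layout_def
proof (intro conjI allI impI)
  have assg: "assignment I (nmem s ''parent'')"
    using opt by (simp add: optimal_assignment_def)
  have embedding: "embedding_for I G (output_pos I s)" for G
    by (simp add: embedding_for_def output_pos_def)
  show "valid_layout I (output_layout I s)"
    using valid_direct_topology[OF inst(1) assg] embedding
    by (simp add: valid_layout_def output_layout_direct[OF direct assg])
  fix L assume "valid_layout I L"
  then obtain f where "assignment I f" "assignment_cost I f \<le> layout_cost I L"
    using assignment_of_layout[OF inst(2)] by blast
  then show "layout_cost I (output_layout I s) \<le> layout_cost I L"
    using opt unfolding optimal_assignment_def output_layout_direct[OF direct assg]
      layout_cost_direct_topology[OF embedding] by fastforce
qed

lemma correct_outputI:
  assumes inst: "flamecast_instance I" "exponent I = 1 \<or> num_layers I = 0"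
    and infeasible: "num_slots I < num_sources I \<Longrightarrow> nmem s ''feasible'' 0 = 0"
    and feasible: "num_sources I \<le> num_slots I \<Longrightarrow> nmem s ''feasible'' 0 = 1 \<and>
      nmem s ''num_steiner'' 0 = 0 \<and> optimal_assignment I (nmem s ''parent'')"
  shows "correct_output I s"
proof (cases "num_sources I \<le> num_slots I")
  case True
  then have "min_cost_layout I (output_layout I s)"
    using min_cost_layout_output[OF inst] feasible by blast
  then show ?thesis
    using feasible[OF True] unfolding correct_output_def min_cost_layout_def by metis
next
  case False
  then have "\<not> (\<exists>L. valid_layout I L)"
    using assignment_of_layout[OF inst(2)] assignment_num_sources_le by blast
  then show ?thesis
    using infeasible False by (simp add: correct_output_def)
qed

section \<open>The Hungarian method\<close>

definition shift_on :: "'a set \<Rightarrow> real \<Rightarrow> ('a \<Rightarrow> real) \<Rightarrow> 'a \<Rightarrow> real" where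
  "shift_on A \<delta> f = override_on f (\<lambda>x. f x + \<delta>) A"

lemma shift_on_apply: "shift_on A \<delta> f x = (if x \<in> A then f x + \<delta> else f x)"
  by (simp add: shift_on_def override_on_def)

lemma shift_on_insert: "a \<notin> A \<Longrightarrow> shift_on (insert a A) \<delta> f = (shift_on A \<delta> f)(a := f a + \<delta>)"
  by (simp add: shift_on_def override_on_insert)

text \<open>
  Rows and columns are numbered from 1, and \<open>p j = 0\<close> means that column \<open>j\<close> is unmatched. Column 0
  is a virtual partner of the row being inserted: it is exempt from the tightness conditions.
\<close>

type_synonym matching = "nat \<Rightarrow> nat"
type_synonym potential = "nat \<Rightarrow> real"

locale assignment_problem =
  fixes rows cols :: nat and cost :: "nat \<Rightarrow> nat \<Rightarrow> real"
  assumes rows_le_cols: "rows \<le> cols"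
begin

definition reduced_cost :: "potential \<Rightarrow> potential \<Rightarrow> nat \<Rightarrow> nat \<Rightarrow> real" where
  "reduced_cost u v x j = cost x j - u x - v j"

definition dual_feasible :: "potential \<Rightarrow> potential \<Rightarrow> bool" where
  "dual_feasible u v \<longleftrightarrow>
     (\<forall>x \<in> {1..rows}. \<forall>j \<in> {1..cols}. 0 \<le> reduced_cost u v x j) \<and> (\<forall>j \<in> {1..cols}. v j \<le> 0)"

definition dual_value :: "potential \<Rightarrow> potential \<Rightarrow> real" where
  "dual_value u v = (\<Sum>x \<in> {1..rows}. u x) + (\<Sum>j \<in> {1..cols}. v j)"

lemma weak_duality:
  assumes "dual_feasible u v" "inj_on \<sigma> {1..rows}" "\<sigma> ` {1..rows} \<subseteq> {1..cols}"
  shows "dual_value u v \<le> (\<Sum>x \<in> {1..rows}. cost x (\<sigma> x))"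
proof -
  have "(\<Sum>j \<in> \<sigma> ` {1..rows}. - v j) \<le> (\<Sum>j \<in> {1..cols}. - v j)"
    using assms by (intro sum_mono2) (auto simp: dual_feasible_def)
  then have "dual_value u v \<le> (\<Sum>x \<in> {1..rows}. u x) + (\<Sum>j \<in> \<sigma> ` {1..rows}. v j)"
    by (simp add: dual_value_def sum_negf)
  also have "\<dots> = (\<Sum>x \<in> {1..rows}. u x + v (\<sigma> x))"
    using assms(2) by (simp add: sum.distrib sum.reindex)
  also have "\<dots> \<le> (\<Sum>x \<in> {1..rows}. cost x (\<sigma> x))"
  proof (rule sum_mono)
    fix x assume "x \<in> {1..rows}"
    then have "0 \<le> reduced_cost u v x (\<sigma> x)"
      using assms(1,3) by (simp add: dual_feasible_def image_subset_iff)
    then show "u x + v (\<sigma> x) \<le> cost x (\<sigma> x)"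
      by (simp add: reduced_cost_def)
  qed
  finally show ?thesis .
qed

definition tight_matching :: "nat set \<Rightarrow> nat \<Rightarrow> matching \<Rightarrow> potential \<Rightarrow> potential \<Rightarrow> bool" where
  "tight_matching C r p u v \<longleftrightarrow>
     dual_feasible u v \<and>
     (\<forall>j \<in> C - {0}. if p j = 0 then v j = 0 else reduced_cost u v (p j) j = 0) \<and>
     bij_betw p {j \<in> C. p j \<noteq> 0} {1..r}"

lemma tight_matching_bij_betw: "tight_matching C r p u v \<Longrightarrow> bij_betw p {j \<in> C. p j \<noteq> 0} {1..r}"
  by (simp add: tight_matching_def)

lemma tight_matching_inj_on: "tight_matching C r p u v \<Longrightarrow> inj_on p {j \<in> C. p j \<noteq> 0}"
  by (simp add: tight_matching_def bij_betw_def)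

lemma tight_matching_tight:
  "\<lbrakk>tight_matching C r p u v; j \<in> C - {0}; p j \<noteq> 0\<rbrakk> \<Longrightarrow> reduced_cost u v (p j) j = 0"
  unfolding tight_matching_def by metis

lemma tight_matching_unmatched:
  "\<lbrakk>tight_matching C r p u v; j \<in> C - {0}; p j = 0\<rbrakk> \<Longrightarrow> v j = 0"
  unfolding tight_matching_def by metis

lemma tight_matching_row:
  "\<lbrakk>tight_matching C r p u v; j \<in> C; p j \<noteq> 0\<rbrakk> \<Longrightarrow> p j \<in> {1..r}"
  by (auto dest!: tight_matching_bij_betw bij_betw_apply)

lemma tight_matching_cost:
  assumes "tight_matching {1..cols} rows p u v"
  shows "(\<Sum>j \<in> {j \<in> {1..cols}. p j \<noteq> 0}. cost (p j) j) = dual_value u v"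
proof -
  let ?M = "{j \<in> {1..cols}. p j \<noteq> 0}"
  have "cost (p j) j = u (p j) + v j" if "j \<in> ?M" for j
    using tight_matching_tight[OF assms, of j] that by (simp add: reduced_cost_def)
  then have "(\<Sum>j \<in> ?M. cost (p j) j) = (\<Sum>j \<in> ?M. u (p j) + v j)"
    by (intro sum.cong) simp_all
  also have "\<dots> = (\<Sum>x \<in> {1..rows}. u x) + (\<Sum>j \<in> ?M. v j)"
    using sum.reindex_bij_betw[OF tight_matching_bij_betw[OF assms], of u]
    by (simp add: sum.distrib)
  also have "(\<Sum>j \<in> ?M. v j) = (\<Sum>j \<in> {1..cols}. v j)"
    using tight_matching_unmatched[OF assms] by (intro sum.mono_neutral_left) auto
  finally show ?thesis
    by (simp add: dual_value_def)
qed

lemma tight_matching_empty: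
  assumes "\<And>x j. 0 \<le> cost x j"
  shows "tight_matching C 0 (\<lambda>_. 0) (\<lambda>_. 0) (\<lambda>_. 0)"
  using assms by (simp add: tight_matching_def dual_feasible_def reduced_cost_def bij_betw_def)

lemma tight_matching_remove_unmatched:
  assumes "tight_matching C r p u v" "p c = 0"
  shows "tight_matching (C - {c}) r p u v"
proof -
  have "{j \<in> C - {c}. p j \<noteq> 0} = {j \<in> C. p j \<noteq> 0}"
    using assms(2) by auto
  then show ?thesis
    using assms(1) by (simp add: tight_matching_def)
qed

lemma tight_matching_insert_virtual:
  assumes "tight_matching {1..cols} r p u v"
  shows "tight_matching {..cols} (Suc r) (p(0 := Suc r)) u v"
proof -
  let ?M = "{j \<in> {1..cols}. p j \<noteq> 0}" and ?p = "p(0 := Suc r)"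
  have "bij_betw ?p ?M {1..r}"
    using bij_betw_cong[of ?M ?p p] tight_matching_bij_betw[OF assms] by auto
  then have "bij_betw ?p (insert 0 ?M) (insert (?p 0) {1..r})"
    using notIn_Un_bij_betw[of 0 ?M ?p "{1..r}"] by simp
  moreover have "insert 0 ?M = {j \<in> {..cols}. ?p j \<noteq> 0}"
    by auto
  moreover have "insert (?p 0) {1..r} = {1..Suc r}"
    by auto
  ultimately show ?thesis
    using assms by (simp add: tight_matching_def)
qed

lemma tight_matching_move_hole:
  assumes matching: "tight_matching (C - {h}) r p u v"
    and h: "h \<in> C - {0}" and k: "k \<in> C - {h}" "p k \<noteq> 0"
    and tight: "reduced_cost u v (p k) h = 0"
  shows "tight_matching (C - {k}) r (p(h := p k)) u v"
proof -
  let ?p = "p(h := p k)" and ?M = "{j \<in> C - {h}. p j \<noteq> 0}"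
  have bij: "bij_betw p ?M {1..r}"
    by (rule tight_matching_bij_betw[OF matching])
  have "bij_betw p (?M - {k}) ({1..r} - {p k})"
    using bij_betw_DiffI[OF bij, of "{k}" "{p k}"] k tight_matching_row[OF matching k(1,2)]
    by (simp add: bij_betw_def)
  then have "bij_betw ?p (?M - {k}) ({1..r} - {p k})"
    by (subst bij_betw_cong[of _ _ p]) auto
  then have "bij_betw ?p (insert h (?M - {k})) (insert (?p h) ({1..r} - {p k}))"
    using notIn_Un_bij_betw[of h "?M - {k}" ?p "{1..r} - {p k}"] by simp
  moreover have "insert h (?M - {k}) = {j \<in> C - {k}. ?p j \<noteq> 0}"
    using h k by auto
  moreover have "insert (?p h) ({1..r} - {p k}) = {1..r}"
    using tight_matching_row[OF matching k(1,2)] by auto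
  ultimately show ?thesis
    using matching tight h k by (auto simp: tight_matching_def)
qed

definition attached :: "matching \<Rightarrow> potential \<Rightarrow> potential \<Rightarrow> (nat \<Rightarrow> nat) \<Rightarrow> nat set \<Rightarrow> nat \<Rightarrow> bool" where
  "attached p u v w U c \<longleftrightarrow> c \<in> {1..cols} - U \<and> w c \<in> U \<and> reduced_cost u v (p (w c)) c = 0"

text \<open>
  \<open>w\<close> maps a column to its parent. The edge from \<open>j\<close> to \<open>w j\<close> stands for the two edges of an
  alternating path that join \<open>j\<close> to the row \<open>p (w j)\<close> and that row to \<open>w j\<close>.
\<close>

inductive alternating_tree :: "matching \<Rightarrow> potential \<Rightarrow> potential \<Rightarrow> (nat \<Rightarrow> nat) \<Rightarrow> nat set \<Rightarrow> bool"
  for p u v w where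
  root: "p 0 \<noteq> 0 \<Longrightarrow> alternating_tree p u v w {0}"
| grow: "\<lbrakk>alternating_tree p u v w U; attached p u v w U c; p c \<noteq> 0\<rbrakk>
    \<Longrightarrow> alternating_tree p u v w (insert c U)"

lemma alternating_tree_columns: "alternating_tree p u v w U \<Longrightarrow> U \<subseteq> {j \<in> {..cols}. p j \<noteq> 0}"
  by (induction rule: alternating_tree.induct) (auto simp: attached_def)

lemma alternating_tree_finite: "alternating_tree p u v w U \<Longrightarrow> finite U"
  by (induction rule: alternating_tree.induct) auto

lemma alternating_tree_zero: "alternating_tree p u v w U \<Longrightarrow> 0 \<in> U"
  by (induction rule: alternating_tree.induct) auto

lemma alternating_tree_cong:
  assumes "alternating_tree p u v w U"
    and "\<And>j. j \<in> U \<Longrightarrow> p' j = p j" "\<And>j. j \<in> U \<Longrightarrow> w' j = w j"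
    and "\<And>i j. i \<in> U \<Longrightarrow> j \<in> U \<Longrightarrow> reduced_cost u' v' (p i) j = reduced_cost u v (p i) j"
  shows "alternating_tree p' u' v' w' U"
  using assms
proof (induction rule: alternating_tree.induct)
  case root
  then show ?case
    by (auto intro: alternating_tree.root)
next
  case (grow U c)
  then have "alternating_tree p' u' v' w' U"
    by simp
  moreover have "attached p' u' v' w' U c"
    using grow.hyps(2) grow.prems by (simp add: attached_def)
  ultimately show ?case
    using grow.hyps(3) grow.prems(1) by (auto intro: alternating_tree.grow)
qed

lemma alternating_tree_prune:
  assumes "alternating_tree p u v w U" "j \<in> U" "j \<noteq> 0"
  obtains U' where "U' \<subset> U" "alternating_tree p u v w U'" "attached p u v w U' j"
  using assms
proof (induction arbitrary: thesis rule: alternating_tree.induct)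
  case root
  then show ?case
    by simp
next
  case (grow U c)
  show ?case
  proof (cases "j = c")
    case True
    then show ?thesis
      using grow.prems(1)[of U] grow.hyps by (auto simp: attached_def)
  next
    case False
    then obtain U' where "U' \<subset> U" "alternating_tree p u v w U'" "attached p u v w U' j"
      using grow.IH grow.prems by blast
    then show ?thesis
      using grow.prems(1)[of U'] by blast
  qed
qed

definition frontier :: 
    "matching \<Rightarrow> potential \<Rightarrow> potential \<Rightarrow> (nat \<Rightarrow> nat) \<Rightarrow> (nat \<Rightarrow> real) \<Rightarrow> nat set \<Rightarrow> bool" where
  "frontier p u v w m U \<longleftrightarrow>
     (\<forall>j \<in> {1..cols} - U. w j \<in> U \<and> m j = reduced_cost u v (p (w j)) j \<and>
        (\<forall>y \<in> U. m j \<le> reduced_cost u v (p y) j))"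

lemma frontierD:
  assumes "frontier p u v w m U" "j \<in> {1..cols} - U"
  shows "w j \<in> U" "m j = reduced_cost u v (p (w j)) j" "y \<in> U \<Longrightarrow> m j \<le> reduced_cost u v (p y) j"
  using assms unfolding frontier_def by blast+

definition search :: 
    "nat \<Rightarrow> matching \<Rightarrow> potential \<Rightarrow> potential \<Rightarrow> (nat \<Rightarrow> nat) \<Rightarrow> (nat \<Rightarrow> real) \<Rightarrow> nat set \<Rightarrow> bool" where
  "search r p u v w m U \<longleftrightarrow>
     tight_matching {..cols} r p u v \<and> alternating_tree p u v w U \<and> frontier p u v w m U"

lemma search_inj_on:
  assumes "search r p u v w m U"
  shows "inj_on p U"
proof -
  have "U \<subseteq> {j \<in> {..cols}. p j \<noteq> 0}"
    using assms alternating_tree_columns unfolding search_def by blast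
  then show ?thesis
    using assms tight_matching_inj_on inj_on_subset unfolding search_def by blast
qed

lemma search_row_mem_iff:
  assumes "search r p u v w m U" "j \<in> {..cols}" "p j \<noteq> 0"
  shows "p j \<in> p ` U \<longleftrightarrow> j \<in> U"
proof -
  have "inj_on p {j \<in> {..cols}. p j \<noteq> 0}" "U \<subseteq> {j \<in> {..cols}. p j \<noteq> 0}"
    using assms(1) tight_matching_inj_on alternating_tree_columns unfolding search_def by blast+
  then show ?thesis
    using assms(2,3) by (intro inj_on_image_mem_iff) auto
qed

lemma search_unscanned_exists:
  assumes "search r p u v w m U" "r \<le> rows"
  shows "{1..cols} - U \<noteq> {}"
proof
  assume scanned: "{1..cols} - U = {}"
  have cols: "U \<subseteq> {j \<in> {..cols}. p j \<noteq> 0}" and zero: "0 \<in> U"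
    using assms(1) alternating_tree_columns alternating_tree_zero unfolding search_def by blast+
  have "j \<in> U" if "j \<in> {..cols}" for j
    using scanned zero that by (cases "j = 0") auto
  then have "{j \<in> {..cols}. p j \<noteq> 0} = {..cols}"
    using cols by auto
  then have "bij_betw p {..cols} {1..r}"
    using assms(1) tight_matching_bij_betw[of "{..cols}" r p u v] by (simp add: search_def)
  then have "card {..cols} = card {1..r}"
    by (rule bij_betw_same_card)
  then show False
    using rows_le_cols assms(2) by simp
qed

lemma search_start:
  assumes "tight_matching {..cols} r p u v" "p 0 \<noteq> 0"
    and "\<And>j. j \<in> {1..cols} \<Longrightarrow> w j = 0 \<and> m j = reduced_cost u v (p 0) j"
  shows "search r p u v w m {0}"
  using assms alternating_tree.root by (simp add: search_def frontier_def)

lemma search_frontier_attached: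
  assumes "search r p u v w m U" "c \<in> {1..cols} - U" "m c = 0"
  shows "attached p u v w U c"
  using assms unfolding search_def frontier_def attached_def by metis

definition improved :: 
    "matching \<Rightarrow> potential \<Rightarrow> potential \<Rightarrow> (nat \<Rightarrow> real) \<Rightarrow> nat set \<Rightarrow> nat \<Rightarrow> nat set" where
  "improved p u v m U c = {j \<in> {1..cols} - insert c U. reduced_cost u v (p c) j < m j}"

lemma frontier_scan:
  fixes p u v m U c
  defines "D \<equiv> improved p u v m U c"
  assumes frontier: "frontier p u v w m U"
  shows "frontier p u v (override_on w (\<lambda>_. c) D) (override_on m (reduced_cost u v (p c)) D)
    (insert c U)"
  unfolding frontier_def
proof
  let ?w = "override_on w (\<lambda>_. c) D" and ?m = "override_on m (reduced_cost u v (p c)) D"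
  fix j assume j: "j \<in> {1..cols} - insert c U"
  then have "j \<in> {1..cols} - U"
    by simp
  note old = frontierD[OF frontier this]
  show "?w j \<in> insert c U \<and> ?m j = reduced_cost u v (p (?w j)) j \<and>
      (\<forall>y \<in> insert c U. ?m j \<le> reduced_cost u v (p y) j)"
  proof (cases "reduced_cost u v (p c) j < m j")
    case True
    then have "j \<in> D"
      using j by (simp add: D_def improved_def)
    then show ?thesis
      using True old(3) by (auto intro: order.trans less_imp_le)
  next
    case False
    then have "j \<notin> D"
      by (simp add: D_def improved_def)
    then show ?thesis
      using False old by auto
  qed
qed

lemma search_scan:
  fixes p u v m U c
  defines "D \<equiv> improved p u v m U c"
  assumes search: "search r p u v w m U"
    and c: "c \<in> {1..cols} - U" "m c = 0" "p c \<noteq> 0"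
  shows "search r p u v (override_on w (\<lambda>_. c) D) (override_on m (reduced_cost u v (p c)) D)
    (insert c U)"
proof -
  have "alternating_tree p u v w (insert c U)"
    using search search_frontier_attached[OF search c(1,2)] c(3)
    by (intro alternating_tree.grow) (simp_all add: search_def)
  then have "alternating_tree p u v (override_on w (\<lambda>_. c) D) (insert c U)"
    by (rule alternating_tree_cong) (auto simp: D_def improved_def override_on_def)
  then show ?thesis
    using search frontier_scan by (simp add: search_def D_def)
qed

lemma reduced_cost_shift:
  "reduced_cost (shift_on A \<delta> u) (shift_on B (- \<delta>) v) x j =
     reduced_cost u v x j - (if x \<in> A then \<delta> else 0) + (if j \<in> B then \<delta> else 0)"
  by (simp add: reduced_cost_def shift_on_apply)

lemma dual_feasible_shift:
  assumes "dual_feasible u v" "0 \<le> \<delta>"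
    and "\<And>x j. x \<in> A \<Longrightarrow> j \<in> {1..cols} - B \<Longrightarrow> \<delta> \<le> reduced_cost u v x j"
  shows "dual_feasible (shift_on A \<delta> u) (shift_on B (- \<delta>) v)"
  unfolding dual_feasible_def
proof (intro conjI ballI)
  fix x j assume "x \<in> {1..rows}" "j \<in> {1..cols}"
  then show "0 \<le> reduced_cost (shift_on A \<delta> u) (shift_on B (- \<delta>) v) x j"
    using assms by (auto simp: dual_feasible_def reduced_cost_shift)
next
  fix j assume "j \<in> {1..cols}"
  then have "v j \<le> 0"
    using assms(1) by (simp add: dual_feasible_def)
  then show "shift_on B (- \<delta>) v j \<le> 0"
    using assms(2) by (simp add: shift_on_apply)
qed

lemma search_dual_feasible_shift:
  assumes search: "search r p u v w m U" "r \<le> rows"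
    and d: "is_arg_min m (\<lambda>j. j \<in> {1..cols} - U) d"
  shows "dual_feasible (shift_on (p ` U) (m d) u) (shift_on U (- m d) v)"
proof -
  have feasible: "dual_feasible u v" and matching: "tight_matching {..cols} r p u v"
    and tree: "alternating_tree p u v w U" and frontier: "frontier p u v w m U"
    using search(1) by (simp_all add: search_def tight_matching_def)
  have d_unscanned: "d \<in> {1..cols} - U"
    using d by (simp add: is_arg_min_linorder)
  note parent = frontierD(1,2)[OF frontier d_unscanned]
  have "p (w d) \<in> {1..rows}"
    using tight_matching_row[OF matching, of "w d"] alternating_tree_columns[OF tree] parent(1)
      search(2) by auto
  then have "0 \<le> m d"
    using feasible d_unscanned parent(2) by (simp add: dual_feasible_def)
  moreover have "m d \<le> reduced_cost u v x j" if "x \<in> p ` U" "j \<in> {1..cols} - U" for x j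
  proof -
    have "m d \<le> m j"
      using d that(2) by (simp add: is_arg_min_linorder)
    also have "m j \<le> reduced_cost u v x j"
      using frontierD(3)[OF frontier that(2)] that(1) by blast
    finally show ?thesis .
  qed
  ultimately show ?thesis
    using feasible by (intro dual_feasible_shift)
qed

lemma search_shift:
  assumes search: "search r p u v w m U" "r \<le> rows"
    and d: "is_arg_min m (\<lambda>j. j \<in> {1..cols} - U) d"
  shows "search r p (shift_on (p ` U) (m d) u) (shift_on U (- m d) v) w
    (shift_on ({..cols} - U) (- m d) m) U"
proof -
  let ?u = "shift_on (p ` U) (m d) u" and ?v = "shift_on U (- m d) v"
  have matching: "tight_matching {..cols} r p u v" and tree: "alternating_tree p u v w U"
    and frontier: "frontier p u v w m U"
    using search(1) by (auto simp: search_def)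
  have "if p j = 0 then ?v j = 0 else reduced_cost ?u ?v (p j) j = 0" if "j \<in> {..cols} - {0}" for j
    using matching that alternating_tree_columns[OF tree] search_row_mem_iff[OF search(1), of j]
    by (auto simp: tight_matching_def reduced_cost_shift shift_on_apply)
  then have "tight_matching {..cols} r p ?u ?v"
    using search_dual_feasible_shift[OF search d] tight_matching_bij_betw[OF matching]
    by (simp add: tight_matching_def)
  moreover have "alternating_tree p ?u ?v w U"
    by (rule alternating_tree_cong[OF tree]) (auto simp: reduced_cost_shift)
  moreover have "frontier p ?u ?v w (shift_on ({..cols} - U) (- m d) m) U"
    unfolding frontier_def
    using frontierD[OF frontier] by (simp add: reduced_cost_shift shift_on_apply)
  ultimately show ?thesis
    by (simp add: search_def)
qed

text \<open>
  Column \<open>h\<close>, the end of what is left of the augmenting path, is a hole in the matching: its entry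
  in \<open>p\<close> is stale. Not more than \<open>k\<close> edges of the path are left.
\<close>

definition augmenting :: 
    "nat \<Rightarrow> nat \<Rightarrow> nat \<Rightarrow> matching \<Rightarrow> potential \<Rightarrow> potential \<Rightarrow> (nat \<Rightarrow> nat) \<Rightarrow> bool" where
  "augmenting r k h p u v w \<longleftrightarrow>
     tight_matching ({..cols} - {h}) r p u v \<and>
     (h \<noteq> 0 \<longrightarrow> (\<exists>U. alternating_tree p u v w U \<and> attached p u v w U h \<and> card U \<le> k))"

lemma augmenting_start:
  assumes "search r p u v w m U" "c \<in> {1..cols} - U" "m c = 0" "p c = 0"
  shows "augmenting r (card U) c p u v w"
  using assms search_frontier_attached[OF assms(1-3)]
  by (auto simp: augmenting_def search_def intro: tight_matching_remove_unmatched)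

lemma augmenting_step:
  assumes augmenting: "augmenting r k h p u v w" and h: "h \<noteq> 0"
  shows "\<exists>l<k. augmenting r l (w h) (p(h := p (w h))) u v w"
proof -
  let ?p = "p(h := p (w h))"
  obtain U where tree: "alternating_tree p u v w U" and attached: "attached p u v w U h"
    and card: "card U \<le> k"
    using augmenting h by (auto simp: augmenting_def)
  have parent: "w h \<in> U" "w h \<in> {..cols}" "p (w h) \<noteq> 0" and hole: "h \<in> {1..cols}" "h \<notin> U"
    using attached alternating_tree_columns[OF tree] by (auto simp: attached_def)
  have matching: "tight_matching ({..cols} - {w h}) r ?p u v"
    by (rule tight_matching_move_hole)
      (use augmenting attached parent hole in \<open>auto simp: augmenting_def attached_def\<close>)
  show ?thesis
  proof (cases "w h = 0")
    case True
    moreover have "0 < k"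
    proof -
      have "0 < card U"
        using parent(1) alternating_tree_finite[OF tree] by (subst card_gt_0_iff) auto
      then show ?thesis
        using card by simp
    qed
    ultimately show ?thesis
      using matching by (auto simp: augmenting_def)
  next
    case False
    then obtain U' where U': "U' \<subset> U" "alternating_tree p u v w U'" "attached p u v w U' (w h)"
      using alternating_tree_prune[OF tree parent(1)] by blast
    have "alternating_tree ?p u v w U'"
      by (rule alternating_tree_cong[OF U'(2)]) (use U'(1) hole(2) in auto)
    moreover have "attached ?p u v w U' (w h)"
      using U' hole(2) by (auto simp: attached_def)
    moreover have "card U' < k"
      using psubset_card_mono[OF alternating_tree_finite[OF tree] U'(1)] card by simp
    ultimately show ?thesis
      using matching by (auto simp: augmenting_def)
  qed
qed

lemma augmenting_end:
  assumes "augmenting r k 0 p u v w"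
  shows "tight_matching {1..cols} r p u v"
proof -
  have "{..cols} - {0} = {1..cols}"
    by auto
  then show ?thesis
    using assms by (simp add: augmenting_def)
qed

end

section \<open>Splitting sinks into slots\<close>

lemma inj_into_blocks:
  assumes "finite A" "\<And>t. card {x \<in> A. f x = t} \<le> c"
  obtains \<sigma> :: "'a \<Rightarrow> nat" where "inj_on \<sigma> A" "\<And>x. x \<in> A \<Longrightarrow> \<sigma> x div c = f x"
proof -
  let ?fibre = "\<lambda>t. {x \<in> A. f x = t}"
  have "\<exists>g. g ` ?fibre t \<subseteq> {..<c} \<and> inj_on g (?fibre t)" for t
    by (rule card_le_inj) (use assms in simp_all)
  then obtain g where g: "\<And>t. g t ` ?fibre t \<subseteq> {..<c}" "\<And>t. inj_on (g t) (?fibre t)"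
    by metis
  define \<sigma> where "\<sigma> x = f x * c + g (f x) x" for x
  have div: "\<sigma> x div c = f x" if "x \<in> A" for x
  proof -
    have "g (f x) x < c"
      using g(1)[of "f x"] that by auto
    then show ?thesis
      by (simp add: \<sigma>_def)
  qed
  have "inj_on \<sigma> A"
  proof (rule inj_onI)
    fix x y assume xy: "x \<in> A" "y \<in> A" and eq: "\<sigma> x = \<sigma> y"
    then have same: "f x = f y"
      using div by metis
    then have "g (f x) x = g (f x) y"
      using eq by (simp add: \<sigma>_def)
    then show "x = y"
      using inj_onD[OF g(2)[of "f x"]] xy same by simp
  qed
  then show thesis
    using that div by blast
qed

lemma card_block: "0 < c \<Longrightarrow> card {j :: nat. j div c = t} = c"
proof -
  assume "0 < c"
  then have "j div c = t \<longleftrightarrow> j \<in> {t * c..<t * c + c}" for j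
    using dividend_less_times_div[of c j] by (auto simp: div_nat_eqI mult.commute add.commute)
  then have "{j. j div c = t} = {t * c..<t * c + c}"
    by blast
  then show ?thesis
    by simp
qed

text \<open>Slots, like the rows and columns of the assignment problem, are numbered from 1.\<close>

definition slot_sink :: "flamecast \<Rightarrow> nat \<Rightarrow> nat" where
  "slot_sink I j = (j - 1) div cap I 0"

definition slot_cost :: "flamecast \<Rightarrow> nat \<Rightarrow> nat \<Rightarrow> real" where
  "slot_cost I x j = norm (source_pos I ! (x - 1) - sink_pos I ! slot_sink I j)"

lemma slot_sink_less: "j \<in> {1..num_slots I} \<Longrightarrow> slot_sink I j < num_sinks I"
  by (auto simp: slot_sink_def num_slots_def less_mult_imp_div_less mult.commute)

lemma card_slots_of_sink_le: "card {j \<in> {1..num_slots I}. slot_sink I j = t} \<le> cap I 0"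
proof (cases "cap I 0 = 0")
  case False
  then have block: "card {j. j div cap I 0 = t} = cap I 0"
    by (simp add: card_block)
  then have "finite {j. j div cap I 0 = t}"
    using False by (metis card.infinite)
  moreover have "{j \<in> {1..num_slots I}. slot_sink I j = t} \<subseteq> Suc ` {j. j div cap I 0 = t}"
    by (force simp: slot_sink_def image_iff)
  ultimately show ?thesis
    using surj_card_le[of "{j. j div cap I 0 = t}"] block by simp
qed (simp add: num_slots_def)

lemma bij_betw_diff_1: "bij_betw (\<lambda>x. x - 1) {1..n} {..<n :: nat}"
  by (rule bij_betw_byWitness[where f' = Suc]) auto

lemma slots_of_assignment:
  assumes "assignment I f"
  obtains \<sigma> where "inj_on \<sigma> {1..num_sources I}" "\<sigma> ` {1..num_sources I} \<subseteq> {1..num_slots I}"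
    "assignment_cost I f = (\<Sum>x \<in> {1..num_sources I}. slot_cost I x (\<sigma> x))"
proof -
  let ?n = "num_sources I"
  obtain \<tau> where \<tau>: "inj_on \<tau> {..<?n}" "\<And>i. i < ?n \<Longrightarrow> \<tau> i div cap I 0 = f i"
    using inj_into_blocks[of "{..<?n}" f "cap I 0"] assms by (auto simp: assignment_def)
  have less: "\<tau> i < num_slots I" if "i < ?n" for i
  proof -
    have "0 < card {k. k < ?n \<and> f k = f i}"
      using that by (subst card_gt_0_iff) auto
    then have "0 < cap I 0"
      using assms less_le_trans unfolding assignment_def by blast
    moreover have "\<tau> i div cap I 0 < num_sinks I"
      using \<tau>(2)[OF that] assms that by (simp add: assignment_def)
    ultimately show ?thesis
      by (simp add: num_slots_def div_less_iff_less_mult mult.commute)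
  qed
  define \<sigma> where "\<sigma> = Suc \<circ> (\<tau> \<circ> (\<lambda>x. x - 1))"
  have shift: "bij_betw (\<lambda>x. x - 1) {1..?n} {..<?n}"
    by (rule bij_betw_diff_1)
  have "inj_on (\<tau> \<circ> (\<lambda>x. x - 1)) {1..?n}"
    using bij_betw_imp_inj_on[OF shift] \<tau>(1)
    by (intro comp_inj_on) (simp_all only: bij_betw_imp_surj_on[OF shift])
  then have "inj_on \<sigma> {1..?n}"
    unfolding \<sigma>_def by (rule comp_inj_on) simp
  moreover have "\<sigma> ` {1..?n} \<subseteq> {1..num_slots I}"
  proof (rule image_subsetI)
    fix x assume "x \<in> {1..?n}"
    then have "x - 1 < ?n"
      by auto
    then show "\<sigma> x \<in> {1..num_slots I}"
      using less[of "x - 1"] by (simp add: \<sigma>_def)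
  qed
  moreover have "assignment_cost I f = (\<Sum>x \<in> {1..?n}. slot_cost I x (\<sigma> x))"
    by (simp add: assignment_cost_def slot_cost_def slot_sink_def \<sigma>_def \<tau>(2) sum.atLeast1_atMost_eq)
  ultimately show thesis
    by (rule that)
qed

locale slot_matching =
  fixes I :: flamecast and C :: "nat set" and p q :: "nat \<Rightarrow> nat"
  assumes slots: "C \<subseteq> {1..num_slots I}" and bij: "bij_betw p C {1..num_sources I}"
    and q: "j \<in> C \<Longrightarrow> q (p j - 1) = slot_sink I j"
begin

lemma bij_betw_source: "bij_betw (\<lambda>j. p j - 1) C {..<num_sources I}"
  using bij_betw_trans[OF bij bij_betw_diff_1] by (simp add: o_def)

lemma slot_of_source:
  assumes "i < num_sources I"
  obtains j where "j \<in> C" "i = p j - 1" "q i = slot_sink I j"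
proof -
  have "i \<in> (\<lambda>j. p j - 1) ` C"
    using bij_betw_imp_surj_on[OF bij_betw_source] assms by simp
  then show thesis
    using that q by blast
qed

lemma assignment_of_slots: "assignment I q"
  unfolding assignment_def
proof (intro conjI allI impI)
  fix i assume "i < num_sources I"
  then obtain j where "j \<in> C" "q i = slot_sink I j"
    by (rule slot_of_source)
  then show "q i < num_sinks I"
    using slots slot_sink_less by auto
next
  fix t
  let ?S = "{j \<in> {1..num_slots I}. slot_sink I j = t}"
  have "{i. i < num_sources I \<and> q i = t} \<subseteq> (\<lambda>j. p j - 1) ` ?S"
  proof
    fix i assume i: "i \<in> {i. i < num_sources I \<and> q i = t}"
    then obtain j where j: "j \<in> C" "i = p j - 1" "q i = slot_sink I j"
      using slot_of_source by blast
    then have "j \<in> ?S"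
      using i slots by auto
    then show "i \<in> (\<lambda>j. p j - 1) ` ?S"
      using j(2) by blast
  qed
  then have "card {i. i < num_sources I \<and> q i = t} \<le> card ?S"
    by (rule surj_card_le[rotated]) simp
  then show "card {i. i < num_sources I \<and> q i = t} \<le> cap I 0"
    using card_slots_of_sink_le[of I t] by simp
qed

lemma assignment_cost_of_slots: "assignment_cost I q = (\<Sum>j \<in> C. slot_cost I (p j) j)"
proof -
  have "assignment_cost I q =
      (\<Sum>j \<in> C. norm (source_pos I ! (p j - 1) - sink_pos I ! q (p j - 1)))"
    unfolding assignment_cost_def by (rule sum.reindex_bij_betw[OF bij_betw_source, symmetric])
  also have "\<dots> = (\<Sum>j \<in> C. slot_cost I (p j) j)"
    by (rule sum.cong) (simp_all only: slot_cost_def q)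
  finally show ?thesis .
qed

end

locale slot_assignment =
  fixes I :: flamecast
  assumes num_sources_le: "num_sources I \<le> num_slots I"
begin

sublocale assignment_problem "num_sources I" "num_slots I" "slot_cost I"
  by unfold_locales (rule num_sources_le)

lemma optimal_assignment_of_matching:
  assumes matching: "tight_matching {1..num_slots I} (num_sources I) p u v"
    and q: "\<And>j. j \<in> {1..num_slots I} \<Longrightarrow> p j \<noteq> 0 \<Longrightarrow> q (p j - 1) = slot_sink I j"
  shows "optimal_assignment I q"
proof -
  let ?C = "{j \<in> {1..num_slots I}. p j \<noteq> 0}"
  interpret slot_matching I ?C p q
    by unfold_locales (use tight_matching_bij_betw[OF matching] q in auto)
  have "assignment_cost I q \<le> assignment_cost I f" if "assignment I f" for f
  proof -
    obtain \<sigma> where \<sigma>: "inj_on \<sigma> {1..num_sources I}" "\<sigma> ` {1..num_sources I} \<subseteq> {1..num_slots I}"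
      "assignment_cost I f = (\<Sum>x \<in> {1..num_sources I}. slot_cost I x (\<sigma> x))"
      by (rule slots_of_assignment[OF \<open>assignment I f\<close>])
    have "assignment_cost I q = (\<Sum>j \<in> ?C. slot_cost I (p j) j)"
      by (rule assignment_cost_of_slots)
    also have "\<dots> = dual_value u v"
      by (rule tight_matching_cost[OF matching])
    also have "\<dots> \<le> assignment_cost I f"
      unfolding \<sigma>(3) using matching by (intro weak_duality \<sigma>(1,2)) (simp add: tight_matching_def)
    finally show ?thesis .
  qed
  then show ?thesis
    using assignment_of_slots by (simp add: optimal_assignment_def)
qed

end

section \<open>The program\<close>

abbreviation columns :: nexp where
  "columns \<equiv> NAdd (nreg ''slots'') (NConst 1)"

abbreviation unused :: bexp where
  "unused \<equiv> NLess (NCell ''used'' (nreg ''j'')) (NConst 1)"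

text \<open>
  Used as a register, \<open>capacities\<close> holds \<open>c\<^sub>0\<close>. Row \<open>x\<close> of the assignment problem is source \<open>x - 1\<close>.
\<close>

definition add_slot :: com where
  "add_slot = (ninc ''slots'' ;; NAssign ''owner'' (nreg ''slots'') (nreg ''j''))"

definition split_sink :: com where
  "split_sink = for_range ''k'' 0 (nreg ''capacities'') add_slot"

definition build_slots :: com where
  "build_slots = for_range ''j'' 0 (nreg ''num_sinks'') split_sink"

definition distance_exp :: rexp where
  "distance_exp =
     (let dx = RSub (RCell ''source_x'' (NSub (nreg ''i'') (NConst 1)))
                 (RCell ''sink_x'' (NCell ''owner'' (nreg ''j'')));
          dy = RSub (RCell ''source_y'' (NSub (nreg ''i'') (NConst 1)))
                 (RCell ''sink_y'' (NCell ''owner'' (nreg ''j'')))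
      in RSqrt (RAdd (RMul dx dx) (RMul dy dy)))"

definition reduced_cost_exp :: rexp where
  "reduced_cost_exp =
     RSub (RSub distance_exp (RCell ''u'' (nreg ''i''))) (RCell ''v'' (nreg ''j''))"

definition start_column :: com where
  "start_column =
     (NAssign ''used'' (nreg ''j'') (NConst 0) ;;
      NAssign ''prev'' (nreg ''j'') (NConst 0) ;;
      RAssign ''slack'' (nreg ''j'') reduced_cost_exp)"

definition enter_row :: com where
  "enter_row =
     (NAssign ''mate'' (NConst 0) (nreg ''row'') ;;
      NAssign ''used'' (NConst 0) (NConst 1) ;;
      nset ''i'' (nreg ''row''))"

definition start_search :: com where
  "start_search = (enter_row ;; for_range ''j'' 1 columns start_column)"

text \<open>As long as \<open>cur\<close> is 0, no column has been selected.\<close>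

definition select_column :: com where
  "select_column =
     Cond (BAnd unused (BOr (NLess (nreg ''cur'') (NConst 1))
             (RLess (RCell ''slack'' (nreg ''j'')) (RCell ''slack'' (nreg ''cur'')))))
       (nset ''cur'' (nreg ''j''))
       Skip"

definition select :: com where
  "select = (nset ''cur'' (NConst 0) ;; for_range ''j'' 1 columns select_column)"

definition shift_column :: com where
  "shift_column =
     Cond unused
       (RAssign ''slack'' (nreg ''j'') (RSub (RCell ''slack'' (nreg ''j'')) (rreg ''delta'')))
       (RAssign ''u'' (NCell ''mate'' (nreg ''j''))
          (RAdd (RCell ''u'' (NCell ''mate'' (nreg ''j''))) (rreg ''delta'')) ;;
        RAssign ''v'' (nreg ''j'') (RSub (RCell ''v'' (nreg ''j'')) (rreg ''delta'')))"

definition shift :: com where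
  "shift =
     (rset ''delta'' (RCell ''slack'' (nreg ''cur'')) ;; for_range ''j'' 0 columns shift_column)"

definition enter_column :: com where
  "enter_column =
     (NAssign ''used'' (nreg ''cur'') (NConst 1) ;; nset ''i'' (NCell ''mate'' (nreg ''cur'')))"

definition relax_column :: com where
  "relax_column =
     Cond unused
       (rset ''x'' reduced_cost_exp ;;
        Cond (RLess (rreg ''x'') (RCell ''slack'' (nreg ''j'')))
          (RAssign ''slack'' (nreg ''j'') (rreg ''x'') ;;
           NAssign ''prev'' (nreg ''j'') (nreg ''cur''))
          Skip)
       Skip"

definition scan :: com where
  "scan = (enter_column ;; for_range ''j'' 1 columns relax_column)"

definition search_loop :: com where
  "search_loop =
     While (NLess (NConst 0) (NCell ''mate'' (nreg ''cur''))) (scan ;; select ;; shift)"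

definition augment_edge :: com where
  "augment_edge =
     (nset ''k'' (NCell ''prev'' (nreg ''cur'')) ;;
      NAssign ''mate'' (nreg ''cur'') (NCell ''mate'' (nreg ''k'')) ;;
      nset ''cur'' (nreg ''k''))"

definition augment :: com where
  "augment = While (NLess (NConst 0) (nreg ''cur'')) augment_edge"

definition insert_row :: com where
  "insert_row = (start_search ;; (select ;; shift) ;; search_loop ;; augment)"

definition write_parent :: com where
  "write_parent =
     Cond (NLess (NConst 0) (NCell ''mate'' (nreg ''j'')))
       (NAssign ''parent'' (NSub (NCell ''mate'' (nreg ''j'')) (NConst 1))
          (NCell ''owner'' (nreg ''j'')))
       Skip"

definition insert_rows :: com where
  "insert_rows = for_range ''row'' 1 (NAdd (nreg ''num_sources'') (NConst 1)) insert_row"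

definition write_parents :: com where
  "write_parents = for_range ''j'' 1 columns write_parent"

definition hungarian :: com where
  "hungarian =
     (build_slots ;;
      Cond (NLess (nreg ''slots'') (nreg ''num_sources''))
        Skip
        (nset ''feasible'' (NConst 1) ;; insert_rows ;; write_parents))"

lemma writes [simp]:
  "nwrites add_slot = {''slots'', ''owner''}" "rwrites add_slot = {}"
  "nwrites split_sink = {''k'', ''slots'', ''owner''}" "rwrites split_sink = {}"
  "nwrites build_slots = {''j'', ''k'', ''slots'', ''owner''}" "rwrites build_slots = {}"
  "nwrites start_column = {''used'', ''prev''}" "rwrites start_column = {''slack''}"
  "nwrites enter_row = {''mate'', ''used'', ''i''}" "rwrites enter_row = {}"
  "nwrites start_search = {''mate'', ''used'', ''i'', ''j'', ''prev''}"
  "rwrites start_search = {''slack''}"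
  "nwrites select_column = {''cur''}" "rwrites select_column = {}"
  "nwrites select = {''cur'', ''j''}" "rwrites select = {}"
  "nwrites shift_column = {}" "rwrites shift_column = {''slack'', ''u'', ''v''}"
  "nwrites shift = {''j''}" "rwrites shift = {''delta'', ''slack'', ''u'', ''v''}"
  "nwrites enter_column = {''used'', ''i''}" "rwrites enter_column = {}"
  "nwrites relax_column = {''prev''}" "rwrites relax_column = {''x'', ''slack''}"
  "nwrites scan = {''used'', ''i'', ''j'', ''prev''}" "rwrites scan = {''x'', ''slack''}"
  "nwrites search_loop = {''used'', ''i'', ''j'', ''prev'', ''cur''}"
  "rwrites search_loop = {''x'', ''slack'', ''delta'', ''u'', ''v''}"
  "nwrites augment_edge = {''k'', ''mate'', ''cur''}" "rwrites augment_edge = {}"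
  "nwrites augment = {''k'', ''mate'', ''cur''}" "rwrites augment = {}"
  "nwrites insert_row = {''mate'', ''used'', ''i'', ''j'', ''prev'', ''cur'', ''k''}"
  "rwrites insert_row = {''x'', ''slack'', ''delta'', ''u'', ''v''}"
  "nwrites insert_rows = {''row'', ''mate'', ''used'', ''i'', ''j'', ''prev'', ''cur'', ''k''}"
  "rwrites insert_rows = {''x'', ''slack'', ''delta'', ''u'', ''v''}"
  "nwrites write_parent = {''parent''}" "rwrites write_parent = {}"
  "nwrites write_parents = {''j'', ''parent''}" "rwrites write_parents = {}"
  by (auto simp: add_slot_def split_sink_def build_slots_def start_column_def enter_row_def
      start_search_def select_column_def select_def shift_column_def shift_def enter_column_def
      relax_column_def scan_def search_loop_def augment_edge_def augment_def insert_row_def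
      insert_rows_def write_parent_def write_parents_def)

definition slots_built :: "flamecast \<Rightarrow> nat \<Rightarrow> state \<Rightarrow> bool" where
  "slots_built I N s \<longleftrightarrow>
     nmem s ''slots'' 0 = N \<and> (\<forall>j \<in> {1..N}. nmem s ''owner'' j = slot_sink I j)"

lemma slots_built_Suc:
  assumes "slots_built I N s" "nmem s ''j'' 0 = slot_sink I (Suc N)"
  shows "slots_built I (Suc N) (exec add_slot s)"
  using assms by (auto simp: slots_built_def add_slot_def atLeastAtMostSuc_conv)

lemma halts_split_sink:
  assumes slots: "slots_built I (t * cap I 0) s"
    and input: "nmem s ''j'' 0 = t" "nmem s ''capacities'' 0 = cap I 0"
  shows "halts_within (30 * cap I 0 + 9) split_sink s (slots_built I (Suc t * cap I 0))"
proof -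
  have "halts_within (30 * cap I 0 + 9) split_sink s (slots_built I (t * cap I 0 + cap I 0))"
    unfolding split_sink_def
  proof (rule halts_within_for_range_exec[where Inv = "\<lambda>k. slots_built I (t * cap I 0 + k)"])
    fix k s' assume k: "k < cap I 0" and inv: "slots_built I (t * cap I 0 + k) s'"
      and frame: "frame (for_range ''k'' 0 (nreg ''capacities'') add_slot) s s'"
    have "slot_sink I (Suc (t * cap I 0 + k)) = t"
      using k by (simp add: slot_sink_def)
    moreover have "nmem s' ''j'' 0 = t"
      using frame input(1) by (simp add: frame_def)
    ultimately show "slots_built I (t * cap I 0 + Suc k) (exec add_slot s')"
      unfolding add_Suc_right by (intro slots_built_Suc inv) simp
  qed (use slots input in \<open>simp_all add: slots_built_def add_slot_def\<close>)
  then show ?thesis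
    by (simp add: add.commute)
qed

lemma halts_build_slots:
  assumes inst: "flamecast_instance I"
  shows "halts_within (100 * (num_slots I + 1)) build_slots (input_state I)
    (slots_built I (num_slots I))"
proof -
  let ?s = "input_state I" and ?T = "30 * cap I 0 + 9"
  let ?time = "(num_sinks I - 0) * (?T + ntime (nreg ''num_sinks'') + 10)
    + ntime (nreg ''num_sinks'') + 7"
  have caps: "capacities I \<noteq> []" "cap I 0 \<in> set (capacities I)"
    using inst by (auto simp: flamecast_instance_def cap_def intro!: nth_mem)
  have input: "nmem ?s ''capacities'' 0 = cap I 0" "nmem ?s ''num_sinks'' 0 = num_sinks I"
    using caps(1) by (simp_all add: input_state_def nat_array_def cap_def)
  have "halts_within ?time build_slots ?s (slots_built I (num_sinks I * cap I 0))"
    unfolding build_slots_def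
  proof (rule halts_within_for_range[where Inv = "\<lambda>t. slots_built I (t * cap I 0)"])
    fix t s' assume "nmem s' ''j'' 0 = t" "slots_built I (t * cap I 0) s'"
      and frame: "frame (for_range ''j'' 0 (nreg ''num_sinks'') split_sink) ?s s'"
    moreover have "nmem s' ''capacities'' 0 = cap I 0"
      using frame input(1) by (simp add: frame_def)
    ultimately show "halts_within ?T split_sink s' (slots_built I (Suc t * cap I 0))"
      by (intro halts_split_sink)
  qed (use input in \<open>simp_all add: slots_built_def input_state_def\<close>)
  then show ?thesis
  proof (rule halts_within_mono)
    have "1 \<le> cap I 0"
      using inst caps(2) by (auto simp: flamecast_instance_def)
    then have sinks_le: "num_sinks I \<le> num_slots I"
      using mult_le_mono1[of 1 "cap I 0" "num_sinks I"] unfolding num_slots_def by linarith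
    have "?time = 30 * num_slots I + 21 * num_sinks I + 9"
      by (simp add: num_slots_def algebra_simps)
    also have "\<dots> \<le> 100 * (num_slots I + 1)"
      using sinks_le by simp
    finally show "?time \<le> 100 * (num_slots I + 1)" .
  qed (simp add: num_slots_def mult.commute)
qed

abbreviation mate :: "state \<Rightarrow> nat \<Rightarrow> nat" where "mate s \<equiv> nmem s ''mate''"
abbreviation prev :: "state \<Rightarrow> nat \<Rightarrow> nat" where "prev s \<equiv> nmem s ''prev''"
abbreviation cur :: "state \<Rightarrow> nat" where "cur s \<equiv> nmem s ''cur'' 0"
abbreviation row_dual :: "state \<Rightarrow> nat \<Rightarrow> real" where "row_dual s \<equiv> rmem s ''u''"
abbreviation col_dual :: "state \<Rightarrow> nat \<Rightarrow> real" where "col_dual s \<equiv> rmem s ''v''"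
abbreviation slack :: "state \<Rightarrow> nat \<Rightarrow> real" where "slack s \<equiv> rmem s ''slack''"

definition arg_min_or_zero :: "(nat \<Rightarrow> real) \<Rightarrow> nat set \<Rightarrow> nat \<Rightarrow> bool" where
  "arg_min_or_zero f A b \<longleftrightarrow> (if A = {} then b = 0 else is_arg_min f (\<lambda>j. j \<in> A) b)"

lemma arg_min_or_zero_insert:
  assumes "arg_min_or_zero f A b" "0 \<notin> A"
  shows "arg_min_or_zero f (insert k A) (if b = 0 \<or> f k < f b then k else b)"
proof (cases "A = {}")
  case False
  then have b: "b \<in> A" "\<forall>j \<in> A. f b \<le> f j" "b \<noteq> 0"
    using assms by (auto simp: arg_min_or_zero_def is_arg_min_linorder)
  then have "\<forall>j \<in> A. f k \<le> f j" if "f k < f b"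
    using that by force
  then show ?thesis
    using b by (simp add: arg_min_or_zero_def is_arg_min_linorder)
qed (use assms in \<open>simp add: arg_min_or_zero_def is_arg_min_linorder\<close>)

context slot_assignment
begin

definition ready :: "state \<Rightarrow> bool" where
  "ready s \<longleftrightarrow>
     slots_built I (num_slots I) s \<and> nmem s ''num_sources'' 0 = num_sources I \<and>
     (\<forall>x \<in> {''source_x'', ''source_y'', ''sink_x'', ''sink_y''}.
        rmem s x = rmem (input_state I) x)"

lemma ready_frame:
  assumes "ready s" "frame c s s'" "nwrites c \<inter> {''slots'', ''owner'', ''num_sources''} = {}"
    "rwrites c \<inter> {''source_x'', ''source_y'', ''sink_x'', ''sink_y''} = {}"
  shows "ready s'"
  using assms by (auto simp: ready_def slots_built_def frame_def)

lemma ready_columns: "ready s \<Longrightarrow> nval columns s = Suc (num_slots I)"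
  by (simp add: ready_def slots_built_def)

lemma rval_reduced_cost_exp:
  assumes ready: "ready s" and i: "nmem s ''i'' 0 \<in> {1..num_sources I}"
    and j: "nmem s ''j'' 0 \<in> {1..num_slots I}"
  shows "rval reduced_cost_exp s =
    reduced_cost (row_dual s) (col_dual s) (nmem s ''i'' 0) (nmem s ''j'' 0)"
proof -
  let ?i = "nmem s ''i'' 0" and ?j = "nmem s ''j'' 0"
  have "?i - 1 < length (source_pos I)" "slot_sink I ?j < length (sink_pos I)"
    using i slot_sink_less[OF j] by (auto simp: num_sources_def num_sinks_def)
  moreover have "nmem s ''owner'' ?j = slot_sink I ?j"
    using ready j by (simp add: ready_def slots_built_def)
  ultimately show ?thesis
    using ready
    by (simp add: reduced_cost_exp_def distance_exp_def Let_def ready_def input_state_def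
        real_array_def reduced_cost_def slot_cost_def norm_vec_def L2_set_def UNIV_2
        power2_eq_square)
qed

definition scanned :: "state \<Rightarrow> nat set" where
  "scanned s = {j \<in> {..num_slots I}. nmem s ''used'' j \<noteq> 0}"

lemma scanned_iff: "j \<le> num_slots I \<Longrightarrow> j \<in> scanned s \<longleftrightarrow> 0 < nmem s ''used'' j"
  by (simp add: scanned_def)

lemma scanned_subset: "scanned s \<subseteq> {..num_slots I}"
  by (auto simp: scanned_def)

lemma scanned_frame: "frame c s s' \<Longrightarrow> ''used'' \<notin> nwrites c \<Longrightarrow> scanned s' = scanned s"
  by (simp add: scanned_def frame_nmem)

abbreviation matched :: "nat \<Rightarrow> state \<Rightarrow> bool" where
  "matched r s \<equiv> tight_matching {1..num_slots I} r (mate s) (row_dual s) (col_dual s)"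

abbreviation searching :: "nat \<Rightarrow> state \<Rightarrow> bool" where
  "searching r s \<equiv> search r (mate s) (row_dual s) (col_dual s) (prev s) (slack s) (scanned s)"

definition at_tight_column :: "state \<Rightarrow> bool" where
  "at_tight_column s \<longleftrightarrow> cur s \<in> {1..num_slots I} - scanned s \<and> slack s (cur s) = 0"

lemma halts_start_columns:
  assumes ready: "ready s" and row: "nmem s ''i'' 0 \<in> {1..num_sources I}"
  shows "halts_within (100 * num_slots I + 30) (for_range ''j'' 1 columns start_column) s
    (\<lambda>s'. nmem s' ''used'' 0 = nmem s ''used'' 0 \<and>
       (\<forall>j \<in> {1..num_slots I}. nmem s' ''used'' j = 0 \<and> prev s' j = 0 \<and>
          slack s' j = reduced_cost (row_dual s) (col_dual s) (nmem s ''i'' 0) j))"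
proof -
  let ?rc = "reduced_cost (row_dual s) (col_dual s) (nmem s ''i'' 0)"
  let ?Inv = "\<lambda>k s'. nmem s' ''used'' 0 = nmem s ''used'' 0 \<and>
    (\<forall>j \<in> {1..<k}. nmem s' ''used'' j = 0 \<and> prev s' j = 0 \<and> slack s' j = ?rc j)"
  have "halts_within (100 * num_slots I + 30) (for_range ''j'' 1 columns start_column) s
      (?Inv (Suc (num_slots I)))"
  proof (rule halts_within_for_range_exec[where Inv = ?Inv])
    fix k s' assume k: "1 \<le> k" "k < Suc (num_slots I)" "nmem s' ''j'' 0 = k" and inv: "?Inv k s'"
      and frame: "frame (for_range ''j'' 1 columns start_column) s s'"
    have "ready s'"
      by (rule ready_frame[OF ready frame]) simp_all
    then have "rval reduced_cost_exp s' = ?rc k"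
      using rval_reduced_cost_exp[of s'] k row frame by (simp add: frame_def)
    moreover have "rval reduced_cost_exp (nupdate x i l t) = rval reduced_cost_exp t"
      if "x \<in> {''used'', ''prev''}" for x i l t
      using that by (auto simp: reduced_cost_exp_def distance_exp_def Let_def)
    ultimately show "?Inv (Suc k) (exec start_column s')"
      using k inv by (auto simp: start_column_def less_Suc_eq)
  qed (use ready_columns[OF ready] in \<open>simp_all add: start_column_def reduced_cost_exp_def
      distance_exp_def Let_def\<close>)
  then show ?thesis
    by (rule halts_within_mono) auto
qed

lemma searching_start:
  assumes "tight_matching {..num_slots I} r (mate s) (row_dual s) (col_dual s)" "mate s 0 \<noteq> 0"
    and "nmem s ''used'' 0 \<noteq> 0"
    and columns: "\<forall>j \<in> {1..num_slots I}. nmem s ''used'' j = 0 \<and> prev s j = 0 \<and>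
      slack s j = reduced_cost (row_dual s) (col_dual s) (mate s 0) j"
  shows "searching r s"
proof -
  have "j \<in> scanned s \<longleftrightarrow> j = 0" for j
    using assms(3) columns by (cases "j = 0") (auto simp: scanned_def)
  then have "scanned s = {0}"
    by blast
  then show ?thesis
    using search_start[OF assms(1,2)] columns by simp
qed

lemma halts_start_search:
  assumes ready: "ready s" and r: "r < num_sources I" and row: "nmem s ''row'' 0 = Suc r"
    and matched: "matched r s"
  shows "halts_within (200 * (num_slots I + 1)) start_search s (searching (Suc r))"
proof -
  let ?for = "for_range ''j'' 1 columns start_column"
  have "halts_within (14 + (100 * num_slots I + 30)) start_search s (searching (Suc r))"
    unfolding start_search_def
  proof (rule halts_within_Seq)
    show "halts_within 14 enter_row s (\<lambda>s'. s' = exec enter_row s)"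
      by (rule halts_within_exec) (simp_all add: enter_row_def)
  next
    fix s1 assume frame1: "frame enter_row s s1" and "s1 = exec enter_row s"
    then have entered: "mate s1 = (mate s)(0 := Suc r)" "nmem s1 ''used'' 0 = 1"
        "nmem s1 ''i'' 0 = Suc r" "row_dual s1 = row_dual s" "col_dual s1 = col_dual s"
      using row by (simp_all add: enter_row_def)
    have ready1: "ready s1"
      by (rule ready_frame[OF ready frame1]) simp_all
    have "nmem s1 ''i'' 0 \<in> {1..num_sources I}"
      using r entered(3) by simp
    then show "halts_within (100 * num_slots I + 30) ?for s1 (searching (Suc r))"
    proof (rule halts_within_mono[OF halts_start_columns[OF ready1] order_refl])
      fix s2 assume frame2: "frame ?for s1 s2"
        and "nmem s2 ''used'' 0 = nmem s1 ''used'' 0 \<and>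
          (\<forall>j \<in> {1..num_slots I}. nmem s2 ''used'' j = 0 \<and> prev s2 j = 0 \<and>
            slack s2 j = reduced_cost (row_dual s1) (col_dual s1) (nmem s1 ''i'' 0) j)"
      then show "searching (Suc r) s2"
        using tight_matching_insert_virtual[OF matched] entered
        by (intro searching_start) (simp_all add: frame_def)
    qed
  qed
  then show ?thesis
    by (rule halts_within_mono) simp_all
qed

lemma select_column_step:
  assumes k: "1 \<le> k" "k \<le> num_slots I" "nmem s ''j'' 0 = k"
    and inv: "arg_min_or_zero (slack s) ({1..<k} - scanned s) (cur s)"
  shows "arg_min_or_zero (slack s) ({1..<Suc k} - scanned s) (cur (exec select_column s))"
proof -
  have columns: "{1..<Suc k} = insert k {1..<k}"
    using k(1) by auto
  show ?thesis
  proof (cases "k \<in> scanned s")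
    case True
    then have "{1..<Suc k} - scanned s = {1..<k} - scanned s"
      unfolding columns by blast
    moreover have "exec select_column s = s"
      using True k by (simp add: select_column_def scanned_iff)
    ultimately show ?thesis
      using inv by (simp only:)
  next
    case False
    then have "{1..<Suc k} - scanned s = insert k ({1..<k} - scanned s)"
      unfolding columns by blast
    moreover have "cur (exec select_column s) =
        (if cur s = 0 \<or> slack s k < slack s (cur s) then k else cur s)"
      using False k by (simp add: select_column_def scanned_iff)
    ultimately show ?thesis
      using arg_min_or_zero_insert[OF inv, of k] by simp
  qed
qed

lemma halts_select:
  assumes ready: "ready s" and unscanned: "{1..num_slots I} - scanned s \<noteq> {}"
  shows "halts_within (100 * (num_slots I + 1)) select s
    (\<lambda>s'. is_arg_min (slack s) (\<lambda>j. j \<in> {1..num_slots I} - scanned s) (cur s'))"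
proof -
  let ?Inv = "\<lambda>k s'. arg_min_or_zero (slack s) ({1..<k} - scanned s) (cur s')"
  have "halts_within (4 + (90 * num_slots I + 30)) select s (?Inv (Suc (num_slots I)))"
    unfolding select_def
  proof (rule halts_within_Seq)
    show "halts_within 4 (nset ''cur'' (NConst 0)) s (\<lambda>s'. cur s' = 0)"
      by (rule halts_within_exec) simp_all
  next
    fix s1 assume frame1: "frame (nset ''cur'' (NConst 0)) s s1" and start: "cur s1 = 0"
    have ready1: "ready s1"
      by (rule ready_frame[OF ready frame1]) simp_all
    show "halts_within (90 * num_slots I + 30) (for_range ''j'' 1 columns select_column) s1
        (?Inv (Suc (num_slots I)))"
    proof (rule halts_within_for_range_exec[where Inv = ?Inv])
      fix k s' assume k: "1 \<le> k" "k < Suc (num_slots I)" "nmem s' ''j'' 0 = k" and inv: "?Inv k s'"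
        and frame: "frame (for_range ''j'' 1 columns select_column) s1 s'"
      have "slack s' = slack s" "scanned s' = scanned s"
        using frame1 frame by (simp_all add: frame_def scanned_def)
      then show "?Inv (Suc k) (exec select_column s')"
        using select_column_step[of k s'] k inv by (simp only: less_Suc_eq_le)
    qed (use start ready_columns[OF ready1] in
        \<open>simp_all add: select_column_def arg_min_or_zero_def\<close>)
  qed
  then have "halts_within (4 + (90 * num_slots I + 30)) select s
      (\<lambda>s'. is_arg_min (slack s) (\<lambda>j. j \<in> {1..num_slots I} - scanned s) (cur s'))"
    using unscanned by (simp only: arg_min_or_zero_def if_False atLeastLessThanSuc_atLeastAtMost)
  then show ?thesis
    by (rule halts_within_mono) simp_all
qed

definition shifted_on :: "nat set \<Rightarrow> real \<Rightarrow> state \<Rightarrow> state \<Rightarrow> bool" where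
  "shifted_on A \<delta> s s' \<longleftrightarrow>
     row_dual s' = shift_on (mate s ` (scanned s \<inter> A)) \<delta> (row_dual s) \<and>
     col_dual s' = shift_on (scanned s \<inter> A) (- \<delta>) (col_dual s) \<and>
     slack s' = shift_on (A - scanned s) (- \<delta>) (slack s)"

lemma shift_column_step:
  assumes shifted: "shifted_on {..<k} \<delta> s s'"
    and k: "k \<le> num_slots I" "nmem s' ''j'' 0 = k"
    and inj: "inj_on (mate s) (scanned s)"
    and unchanged: "mate s' = mate s" "scanned s' = scanned s" and delta: "rmem s' ''delta'' 0 = \<delta>"
  shows "shifted_on {..<Suc k} \<delta> s (exec shift_column s')"
proof -
  let ?U = "scanned s \<inter> {..<k}" and ?V = "{..<k} - scanned s"
  have used: "0 < nmem s' ''used'' k \<longleftrightarrow> k \<in> scanned s"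
    using scanned_iff[OF k(1), of s'] unchanged(2) by simp
  show ?thesis
  proof (cases "k \<in> scanned s")
    case True
    then have columns: "scanned s \<inter> {..<Suc k} = insert k ?U" "{..<Suc k} - scanned s = ?V"
      by (auto simp: less_Suc_eq)
    have "mate s k \<notin> mate s ` ?U" "k \<notin> ?U"
      using inj_onD[OF inj] True by auto
    then show ?thesis
      using shifted True k(2) used unchanged(1) delta unfolding shifted_on_def columns
      by (simp add: shift_column_def shift_on_insert) (simp add: shift_on_apply)
  next
    case False
    then have columns: "scanned s \<inter> {..<Suc k} = ?U" "{..<Suc k} - scanned s = insert k ?V"
      by (auto simp: less_Suc_eq)
    have "k \<notin> ?V"
      by simp
    then show ?thesis
      using shifted False k(2) used delta unfolding shifted_on_def columns
      by (simp add: shift_column_def shift_on_insert) (simp add: shift_on_apply)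
  qed
qed

lemma halts_shift:
  assumes ready: "ready s" and inj: "inj_on (mate s) (scanned s)"
  shows "halts_within (100 * (num_slots I + 1)) shift s
    (shifted_on {..num_slots I} (slack s (cur s)) s)"
proof -
  let ?delta = "slack s (cur s)" and ?init = "rset ''delta'' (RCell ''slack'' (nreg ''cur''))"
  let ?Inv = "\<lambda>k. shifted_on {..<k} ?delta s"
  have "halts_within (5 + (90 * num_slots I + 90)) shift s (?Inv (Suc (num_slots I)))"
    unfolding shift_def
  proof (rule halts_within_Seq)
    show "halts_within 5 ?init s (\<lambda>s'. rmem s' ''delta'' 0 = ?delta)"
      by (rule halts_within_exec) simp_all
  next
    fix s1 assume frame1: "frame ?init s s1" and delta: "rmem s1 ''delta'' 0 = ?delta"
    have ready1: "ready s1"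
      by (rule ready_frame[OF ready frame1]) simp_all
    show "halts_within (90 * num_slots I + 90) (for_range ''j'' 0 columns shift_column) s1
        (?Inv (Suc (num_slots I)))"
    proof (rule halts_within_for_range_exec[where Inv = ?Inv])
      fix k s' assume k: "k < Suc (num_slots I)" "nmem s' ''j'' 0 = k" and inv: "?Inv k s'"
        and frame: "frame (for_range ''j'' 0 columns shift_column) s1 s'"
      have "mate s' = mate s" "scanned s' = scanned s" "rmem s' ''delta'' 0 = ?delta"
        using frame1 frame delta by (simp_all add: frame_def scanned_def)
      then show "?Inv (Suc k) (exec shift_column s')"
        using shift_column_step[OF inv _ k(2) inj] k(1) by simp
    qed (use frame1 ready_columns[OF ready1] in
        \<open>simp_all add: shifted_on_def shift_column_def frame_def shift_on_def\<close>)
  qed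
  then show ?thesis
    unfolding lessThan_Suc_atMost by (rule halts_within_mono) simp_all
qed

lemma halts_select_shift:
  assumes ready: "ready s" and r: "r \<le> num_sources I" and searching: "searching r s"
  shows "halts_within (200 * (num_slots I + 1)) (select ;; shift) s
    (\<lambda>s'. searching r s' \<and> at_tight_column s')"
proof -
  have "halts_within (100 * (num_slots I + 1) + 100 * (num_slots I + 1)) (select ;; shift) s
    (\<lambda>s'. searching r s' \<and> at_tight_column s')"
  proof (rule halts_within_Seq[OF halts_select[OF ready search_unscanned_exists[OF searching r]]])
    fix s1 assume frame1: "frame select s s1"
      and argmin: "is_arg_min (slack s) (\<lambda>j. j \<in> {1..num_slots I} - scanned s) (cur s1)"
    have unchanged: "mate s1 = mate s" "row_dual s1 = row_dual s" "col_dual s1 = col_dual s"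
        "prev s1 = prev s" "slack s1 = slack s" "scanned s1 = scanned s"
      using frame1 by (simp_all add: frame_def scanned_def)
    have ready1: "ready s1"
      by (rule ready_frame[OF ready frame1]) simp_all
    have "inj_on (mate s1) (scanned s1)"
      using search_inj_on[OF searching] by (simp add: unchanged)
    then show "halts_within (100 * (num_slots I + 1)) shift s1
        (\<lambda>s'. searching r s' \<and> at_tight_column s')"
    proof (rule halts_within_mono[OF halts_shift[OF ready1] order_refl])
      fix s2 assume frame2: "frame shift s1 s2"
        and shifted: "shifted_on {..num_slots I} (slack s1 (cur s1)) s1 s2"
      have "mate s2 = mate s" "prev s2 = prev s" "scanned s2 = scanned s" "cur s2 = cur s1"
        using frame2 unchanged by (simp_all add: frame_def scanned_def)
      moreover have "scanned s \<inter> {..num_slots I} = scanned s"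
        using scanned_subset by blast
      ultimately show "searching r s2 \<and> at_tight_column s2"
        using shifted search_shift[OF searching r argmin] argmin
        by (simp add: shifted_on_def unchanged at_tight_column_def is_arg_min_linorder
            shift_on_apply)
    qed
  qed
  then show ?thesis
    by (rule halts_within_mono) simp_all
qed

abbreviation scanned_row_cost :: "state \<Rightarrow> nat \<Rightarrow> real" where
  "scanned_row_cost s \<equiv> reduced_cost (row_dual s) (col_dual s) (mate s (cur s))"

abbreviation improved_columns :: "state \<Rightarrow> nat set" where
  "improved_columns s \<equiv>
     improved (mate s) (row_dual s) (col_dual s) (slack s) (scanned s) (cur s)"

definition relaxed_on :: "nat set \<Rightarrow> state \<Rightarrow> state \<Rightarrow> bool" where
  "relaxed_on D s s' \<longleftrightarrow>
     prev s' = override_on (prev s) (\<lambda>_. cur s) D \<and>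
     slack s' = override_on (slack s) (scanned_row_cost s) D"

lemma relax_column_step:
  assumes relaxed: "relaxed_on (improved_columns s \<inter> {..<k}) s s'"
    and k: "nmem s' ''j'' 0 = k" "k \<in> {1..num_slots I}"
    and cost: "rval reduced_cost_exp s' = scanned_row_cost s k"
    and cur: "cur s \<in> scanned s" and unchanged: "scanned s' = scanned s" "cur s' = cur s"
  shows "relaxed_on (improved_columns s \<inter> {..<Suc k}) s (exec relax_column s')"
proof -
  let ?D = "\<lambda>k. improved_columns s \<inter> {..<k}"
  have columns: "?D (Suc k) = (if k \<in> improved_columns s then insert k (?D k) else ?D k)"
    by (auto simp: less_Suc_eq)
  have "slack s' k = slack s k"
    using relaxed by (simp add: relaxed_on_def override_on_def)
  moreover have "k \<in> improved_columns s \<longleftrightarrow>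
      \<not> 0 < nmem s' ''used'' k \<and> scanned_row_cost s k < slack s k"
    using k(2) cur unchanged(1) scanned_iff[of k s'] by (auto simp: improved_def)
  ultimately show ?thesis
    using relaxed k(1) unchanged(2) unfolding columns
    by (auto simp: relaxed_on_def relax_column_def cost override_on_insert)
qed

lemma halts_relax_columns:
  assumes ready: "ready s" and row: "mate s (cur s) \<in> {1..num_sources I}"
    and entered: "nmem s ''i'' 0 = mate s (cur s)" "cur s \<in> scanned s"
  shows "halts_within (200 * num_slots I + 30) (for_range ''j'' 1 columns relax_column) s
    (relaxed_on (improved_columns s) s)"
proof -
  let ?Inv = "\<lambda>k. relaxed_on (improved_columns s \<inter> {..<k}) s"
  have "halts_within (200 * num_slots I + 30) (for_range ''j'' 1 columns relax_column) s
      (?Inv (Suc (num_slots I)))"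
  proof (rule halts_within_for_range_exec[where Inv = ?Inv])
    fix k s' assume k: "1 \<le> k" "k < Suc (num_slots I)" "nmem s' ''j'' 0 = k" and inv: "?Inv k s'"
      and frame: "frame (for_range ''j'' 1 columns relax_column) s s'"
    have unchanged: "row_dual s' = row_dual s" "col_dual s' = col_dual s"
        "nmem s' ''i'' 0 = nmem s ''i'' 0" "cur s' = cur s" "scanned s' = scanned s"
      using frame by (simp_all add: frame_def scanned_def)
    have "ready s'"
      by (rule ready_frame[OF ready frame]) simp_all
    then have "rval reduced_cost_exp s' = scanned_row_cost s k"
      using rval_reduced_cost_exp[of s'] k row entered(1) unchanged by simp
    then show "?Inv (Suc k) (exec relax_column s')"
      using relax_column_step[OF inv k(3)] k(1,2) entered(2) unchanged by simp
  next
    have "improved_columns s \<inter> {..<1} = {}"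
      by (auto simp: improved_def)
    then show "?Inv 1 s"
      by (simp add: relaxed_on_def)
  qed (use ready_columns[OF ready] in \<open>simp_all add: relaxed_on_def relax_column_def
      reduced_cost_exp_def distance_exp_def Let_def\<close>)
  moreover have all_columns: "improved_columns s \<inter> {..<Suc (num_slots I)} = improved_columns s"
    by (auto simp: improved_def)
  ultimately show ?thesis
    by (simp only: all_columns)
qed

lemma halts_scan_relaxed:
  assumes ready: "ready s" and row: "mate s (cur s) \<in> {1..num_sources I}"
    and cur: "cur s \<in> {1..num_slots I}"
  shows "halts_within (300 * (num_slots I + 1)) scan s
    (\<lambda>s'. scanned s' = insert (cur s) (scanned s) \<and> relaxed_on (improved_columns s) s s')"
    (is "halts_within _ _ _ ?Q")
proof -
  let ?for = "for_range ''j'' 1 columns relax_column"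
  have "halts_within (20 + (200 * num_slots I + 30)) scan s ?Q"
    unfolding scan_def
  proof (rule halts_within_Seq)
    show "halts_within 20 enter_column s (\<lambda>s'. s' = exec enter_column s)"
      by (rule halts_within_exec) (simp_all add: enter_column_def)
  next
    fix s1 assume frame1: "frame enter_column s s1" and s1: "s1 = exec enter_column s"
    have unchanged: "mate s1 = mate s" "row_dual s1 = row_dual s" "col_dual s1 = col_dual s"
        "prev s1 = prev s" "slack s1 = slack s" "cur s1 = cur s"
      using frame1 by (simp_all add: frame_def)
    have entered: "nmem s1 ''i'' 0 = mate s (cur s)" "scanned s1 = insert (cur s) (scanned s)"
      using cur by (auto simp: s1 enter_column_def scanned_def)
    have ready1: "ready s1"
      by (rule ready_frame[OF ready frame1]) simp_all
    have "halts_within (200 * num_slots I + 30) ?for s1 (relaxed_on (improved_columns s1) s1)"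
      by (rule halts_relax_columns[OF ready1]) (use row unchanged entered in simp_all)
    then show "halts_within (200 * num_slots I + 30) ?for s1 ?Q"
    proof (rule halts_within_mono[OF _ order_refl])
      fix s2 assume "frame ?for s1 s2" "relaxed_on (improved_columns s1) s1 s2"
      then show "?Q s2"
        by (simp add: scanned_frame entered relaxed_on_def unchanged improved_def)
    qed
  qed
  then show ?thesis
    by (rule halts_within_mono) simp_all
qed

lemma halts_scan:
  assumes ready: "ready s" and r: "r \<le> num_sources I" and searching: "searching r s"
    and column: "at_tight_column s" "mate s (cur s) \<noteq> 0"
  shows "halts_within (300 * (num_slots I + 1)) scan s
    (\<lambda>s'. searching r s' \<and> scanned s' = insert (cur s) (scanned s))"
proof -
  have cur: "cur s \<in> {1..num_slots I} - scanned s" "slack s (cur s) = 0"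
    using column(1) by (simp_all add: at_tight_column_def)
  have row: "mate s (cur s) \<in> {1..num_sources I}"
    using tight_matching_row[of "{..num_slots I}" r "mate s" "row_dual s" "col_dual s" "cur s"]
      searching column(2) cur(1) r by (simp add: search_def)
  show ?thesis
  proof (rule halts_within_mono[OF halts_scan_relaxed[OF ready row] order_refl])
    fix s' assume "frame scan s s'"
      and "scanned s' = insert (cur s) (scanned s) \<and> relaxed_on (improved_columns s) s s'"
    then show "searching r s' \<and> scanned s' = insert (cur s) (scanned s)"
      using search_scan[OF searching cur column(2)] by (simp add: relaxed_on_def frame_def)
  qed (use cur(1) in simp)
qed

lemma card_scanned_le: "card (scanned s) \<le> num_slots I + 1"
  using card_mono[OF _ scanned_subset[of s]] by simp

lemma halts_search_step:
  assumes ready: "ready s" and r: "r \<le> num_sources I" and searching: "searching r s"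
    and column: "at_tight_column s" "mate s (cur s) \<noteq> 0"
  shows "halts_within (500 * (num_slots I + 1)) (scan ;; select ;; shift) s
    (\<lambda>s'. searching r s' \<and> at_tight_column s' \<and> card (scanned s') = Suc (card (scanned s)))"
    (is "halts_within _ _ _ ?Q")
proof -
  have "halts_within (300 * (num_slots I + 1) + 200 * (num_slots I + 1)) (scan ;; select ;; shift)
      s ?Q"
  proof (rule halts_within_Seq[OF halts_scan[OF ready r searching column]])
    fix s1 assume frame1: "frame scan s s1"
      and scan: "searching r s1 \<and> scanned s1 = insert (cur s) (scanned s)"
    have ready1: "ready s1"
      by (rule ready_frame[OF ready frame1]) simp_all
    have "finite (scanned s)" "cur s \<notin> scanned s"
      using column(1) by (auto simp: at_tight_column_def scanned_def)
    then have card: "card (scanned s1) = Suc (card (scanned s))"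
      using scan by simp
    show "halts_within (200 * (num_slots I + 1)) (select ;; shift) s1 ?Q"
    proof (rule halts_within_mono[OF halts_select_shift[OF ready1 r conjunct1[OF scan]] order_refl])
      fix s2 assume "frame (select ;; shift) s1 s2" "searching r s2 \<and> at_tight_column s2"
      moreover from this have "scanned s2 = scanned s1"
        by (simp add: scanned_frame)
      ultimately show "?Q s2"
        using card by simp
    qed
  qed
  then show ?thesis
    by (rule halts_within_mono) simp_all
qed

lemma halts_search_loop:
  assumes ready: "ready s" and r: "r \<le> num_sources I" and searching: "searching r s"
    and column: "at_tight_column s"
  shows "halts_within (600 * (num_slots I + 1) ^ 2) search_loop s
    (\<lambda>s'. searching r s' \<and> at_tight_column s' \<and> mate s' (cur s') = 0)"
proof -
  let ?M = "num_slots I + 1" and ?test = "NLess (NConst 0) (NCell ''mate'' (nreg ''cur''))"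
  let ?Inv = "\<lambda>k s'. searching r s' \<and> at_tight_column s' \<and> ?M \<le> card (scanned s') + k"
  have "halts_within (?M * (500 * ?M + btime ?test + 1) + btime ?test + 1) search_loop s
      (\<lambda>s'. (\<exists>k. ?Inv k s') \<and> \<not> bval ?test s')"
    unfolding search_loop_def
  proof (rule halts_within_While[where Inv = ?Inv])
    fix k s' assume inv: "?Inv k s'" and frame: "frame (scan ;; select ;; shift) s s'"
      and "bval ?test s'"
    have "ready s'"
      by (rule ready_frame[OF ready frame]) simp_all
    then have "halts_within (500 * ?M) (scan ;; select ;; shift) s' (\<lambda>s''. searching r s'' \<and>
        at_tight_column s'' \<and> card (scanned s'') = Suc (card (scanned s')))"
      using inv r \<open>bval ?test s'\<close> by (intro halts_search_step) simp_all
    then show "halts_within (500 * ?M) (scan ;; select ;; shift) s' (\<lambda>s''. \<exists>j<k. ?Inv j s'')"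
    proof (rule halts_within_mono[OF _ order_refl])
      fix s'' assume "searching r s'' \<and> at_tight_column s'' \<and>
        card (scanned s'') = Suc (card (scanned s'))"
      then show "\<exists>j<k. ?Inv j s''"
        using inv card_scanned_le[of s''] by (intro exI[of _ "k - 1"]) simp
    qed
  qed (use searching column in simp)
  then show ?thesis
    by (rule halts_within_mono) (simp_all add: power2_eq_square algebra_simps)
qed

lemma halts_augment_edge:
  assumes "augmenting r k (cur s) (mate s) u v (prev s)" "cur s \<noteq> 0"
  shows "halts_within 20 augment_edge s
    (\<lambda>s'. \<exists>l<k. augmenting r l (cur s') (mate s') u v (prev s'))"
proof (rule halts_within_exec)
  have "mate (exec augment_edge s) = (mate s)(cur s := mate s (prev s (cur s)))"
    "cur (exec augment_edge s) = prev s (cur s)" "prev (exec augment_edge s) = prev s"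
    by (simp_all add: augment_edge_def)
  then show "\<exists>l<k. augmenting r l (cur (exec augment_edge s)) (mate (exec augment_edge s)) u v
      (prev (exec augment_edge s))"
    using augmenting_step[OF assms] by simp
qed (simp_all add: augment_edge_def)

lemma halts_augment:
  assumes searching: "searching r s" and column: "at_tight_column s" "mate s (cur s) = 0"
  shows "halts_within (40 * (num_slots I + 1)) augment s (matched r)"
proof -
  let ?test = "NLess (NConst 0) (nreg ''cur'')" and ?k = "card (scanned s)"
  let ?Inv = "\<lambda>k s'. augmenting r k (cur s') (mate s') (row_dual s) (col_dual s) (prev s')"
  have "halts_within (?k * (20 + btime ?test + 1) + btime ?test + 1) augment s
      (\<lambda>s'. (\<exists>k. ?Inv k s') \<and> \<not> bval ?test s')"
    unfolding augment_def
  proof (rule halts_within_While[where Inv = ?Inv])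
    show "?Inv ?k s"
      using augmenting_start[OF searching] column by (simp add: at_tight_column_def)
  next
    fix k s' assume "?Inv k s'" "bval ?test s'"
    then show "halts_within 20 augment_edge s' (\<lambda>s''. \<exists>j<k. ?Inv j s'')"
      by (intro halts_augment_edge) simp_all
  qed
  then show ?thesis
  proof (rule halts_within_mono)
    show "?k * (20 + btime ?test + 1) + btime ?test + 1 \<le> 40 * (num_slots I + 1)"
      using card_scanned_le[of s] by simp
  next
    fix s' assume "frame augment s s'" and exit: "(\<exists>k. ?Inv k s') \<and> \<not> bval ?test s'"
    then have "row_dual s' = row_dual s" "col_dual s' = col_dual s" "cur s' = 0"
      by (simp_all add: frame_def)
    then show "matched r s'"
      using exit augmenting_end by auto
  qed
qed

lemma halts_insert_row:
  assumes ready: "ready s" and r: "r < num_sources I" and row: "nmem s ''row'' 0 = Suc r"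
    and matched: "matched r s"
  shows "halts_within (1100 * (num_slots I + 1) ^ 2) insert_row s (matched (Suc r))"
proof -
  let ?M = "num_slots I + 1"
  have "halts_within (200 * ?M + (200 * ?M + (600 * ?M ^ 2 + 40 * ?M))) insert_row s
      (matched (Suc r))"
    unfolding insert_row_def
  proof (rule halts_within_Seq[OF halts_start_search[OF ready r row matched]])
    fix s1 assume frame1: "frame start_search s s1" and searching: "searching (Suc r) s1"
    have ready1: "ready s1"
      by (rule ready_frame[OF ready frame1]) simp_all
    show "halts_within (200 * ?M + (600 * ?M ^ 2 + 40 * ?M))
        ((select ;; shift) ;; search_loop ;; augment) s1 (matched (Suc r))"
    proof (rule halts_within_Seq[OF halts_select_shift[OF ready1 _ searching]])
      fix s2 assume frame2: "frame (select ;; shift) s1 s2"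
        and column: "searching (Suc r) s2 \<and> at_tight_column s2"
      have ready2: "ready s2"
        by (rule ready_frame[OF ready1 frame2]) simp_all
      show "halts_within (600 * ?M ^ 2 + 40 * ?M) (search_loop ;; augment) s2 (matched (Suc r))"
      proof (rule halts_within_Seq[OF halts_search_loop[where r = "Suc r", OF ready2]])
        fix s3 assume "searching (Suc r) s3 \<and> at_tight_column s3 \<and> mate s3 (cur s3) = 0"
        then show "halts_within (40 * ?M) augment s3 (matched (Suc r))"
          by (intro halts_augment) simp_all
      qed (use column r in simp_all)
    qed (use r in simp)
  qed
  then show ?thesis
    by (rule halts_within_mono) (simp_all add: power2_eq_square)
qed

lemma halts_insert_rows:
  assumes ready: "ready s" and matched: "matched 0 s"
  shows "halts_within (1200 * (num_slots I + 1) ^ 3) insert_rows s (matched (num_sources I))"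
proof -
  let ?M = "num_slots I + 1" and ?bound = "NAdd (nreg ''num_sources'') (NConst 1)"
  let ?time = "\<lambda>n. n * (1100 * ?M ^ 2 + ntime ?bound + 10) + ntime ?bound + 7"
  have "halts_within (?time (Suc (num_sources I) - 1)) insert_rows s
      (matched (Suc (num_sources I) - 1))"
    unfolding insert_rows_def
  proof (rule halts_within_for_range[where Inv = "\<lambda>k. matched (k - 1)"])
    fix k s' assume k: "1 \<le> k" "k < Suc (num_sources I)" and row: "nmem s' ''row'' 0 = k"
      and matched: "matched (k - 1) s'"
      and frame: "frame (for_range ''row'' 1 ?bound insert_row) s s'"
    have "ready s'"
      by (rule ready_frame[OF ready frame]) simp_all
    then have "halts_within (1100 * ?M ^ 2) insert_row s' (matched (Suc (k - 1)))"
      using k row by (intro halts_insert_row[OF _ _ _ matched]) auto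
    then show "halts_within (1100 * ?M ^ 2) insert_row s' (matched (Suc k - 1))"
      using k(1) by simp
  qed (use ready matched in \<open>simp_all add: ready_def\<close>)
  then show ?thesis
  proof (rule halts_within_mono)
    have "?time (Suc (num_sources I) - 1) \<le> ?time ?M"
      using num_sources_le by (intro add_right_mono mult_right_mono) auto
    also have "\<dots> \<le> 1200 * ?M ^ 3"
      by (simp add: power2_eq_square power3_eq_cube algebra_simps)
    finally show "?time (Suc (num_sources I) - 1) \<le> 1200 * ?M ^ 3" .
  qed simp
qed

lemma write_parent_step:
  assumes k: "nmem s ''j'' 0 = k" "k \<noteq> 0" and owner: "nmem s ''owner'' k = slot_sink I k"
    and inj: "inj_on (mate s) {j \<in> {1..k}. mate s j \<noteq> 0}"
    and written: "\<And>j. \<lbrakk>j \<in> {1..<k}; mate s j \<noteq> 0\<rbrakk>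
      \<Longrightarrow> nmem s ''parent'' (mate s j - 1) = slot_sink I j"
    and j: "j \<in> {1..<Suc k}" "mate s j \<noteq> 0"
  shows "nmem (exec write_parent s) ''parent'' (mate s j - 1) = slot_sink I j"
proof (cases "j = k")
  case True
  then show ?thesis
    using k owner j(2) by (simp add: write_parent_def)
next
  case False
  have "mate s j - 1 \<noteq> mate s k - 1" if "mate s k \<noteq> 0"
  proof -
    have "mate s j \<noteq> mate s k"
      using inj_onD[OF inj, of j k] False j k(2) that by auto
    then show ?thesis
      using j(2) that by linarith
  qed
  moreover have "nmem s ''parent'' (mate s j - 1) = slot_sink I j"
    using written False j by auto
  ultimately show ?thesis
    using k(1) by (simp add: write_parent_def)
qed

lemma halts_write_parents:
  assumes ready: "ready s" and matched: "matched (num_sources I) s"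
  shows "halts_within (100 * (num_slots I + 1)) write_parents s
    (\<lambda>s'. optimal_assignment I (nmem s' ''parent''))"
proof -
  let ?Inv = "\<lambda>k s'. \<forall>j \<in> {1..<k}. mate s j \<noteq> 0 \<longrightarrow>
    nmem s' ''parent'' (mate s j - 1) = slot_sink I j"
  have "halts_within (100 * (num_slots I + 1)) write_parents s (?Inv (Suc (num_slots I)))"
    unfolding write_parents_def
  proof (rule halts_within_for_range_exec[where Inv = ?Inv])
    fix k s' assume k: "1 \<le> k" "k < Suc (num_slots I)" "nmem s' ''j'' 0 = k" and inv: "?Inv k s'"
      and frame: "frame (for_range ''j'' 1 columns write_parent) s s'"
    have mate: "mate s' = mate s"
      using frame by (simp add: frame_def)
    have "nmem s' ''owner'' k = slot_sink I k"
      using ready frame k by (simp add: ready_def slots_built_def frame_def)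
    moreover have "inj_on (mate s') {j \<in> {1..k}. mate s' j \<noteq> 0}"
      unfolding mate
      by (rule inj_on_subset[OF tight_matching_inj_on[OF matched]]) (use k(2) in auto)
    ultimately show "?Inv (Suc k) (exec write_parent s')"
      using write_parent_step[of s' k] k inv unfolding mate by simp
  qed (use ready_columns[OF ready] in \<open>simp_all add: write_parent_def\<close>)
  then show ?thesis
  proof (rule halts_within_mono[OF _ order_refl])
    fix s' assume "?Inv (Suc (num_slots I)) s'"
    then show "optimal_assignment I (nmem s' ''parent'')"
      by (intro optimal_assignment_of_matching[OF matched]) auto
  qed
qed

lemma halts_solve:
  assumes ready: "ready s" and matched: "matched 0 s"
  shows "halts_within (1300 * (num_slots I + 1) ^ 3) (insert_rows ;; write_parents) s
    (\<lambda>s'. optimal_assignment I (nmem s' ''parent''))"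
proof -
  let ?M = "num_slots I + 1"
  have "halts_within (1200 * ?M ^ 3 + 100 * ?M) (insert_rows ;; write_parents) s
      (\<lambda>s'. optimal_assignment I (nmem s' ''parent''))"
  proof (rule halts_within_Seq[OF halts_insert_rows[OF ready matched]])
    fix s1 assume frame: "frame insert_rows s s1" and "matched (num_sources I) s1"
    moreover have "ready s1"
      by (rule ready_frame[OF ready frame]) simp_all
    ultimately show "halts_within (100 * ?M) write_parents s1
        (\<lambda>s'. optimal_assignment I (nmem s' ''parent''))"
      by (intro halts_write_parents)
  qed
  then show ?thesis
    by (rule halts_within_mono) (simp_all add: power3_eq_cube)
qed

end

lemma halts_hungarian_feasible:
  assumes inst: "flamecast_instance I" "exponent I = 1 \<or> num_layers I = 0"
    and le: "num_sources I \<le> num_slots I"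
    and frame: "frame build_slots (input_state I) s" and slots: "slots_built I (num_slots I) s"
  shows "halts_within (10 + 1300 * (num_slots I + 1) ^ 3)
    (nset ''feasible'' (NConst 1) ;; insert_rows ;; write_parents) s (correct_output I)"
proof -
  interpret slot_assignment I
    by unfold_locales (rule le)
  let ?init = "nset ''feasible'' (NConst 1)"
  show ?thesis
  proof (rule halts_within_Seq)
    show "halts_within 10 ?init s (\<lambda>s'. nmem s' ''feasible'' 0 = 1)"
      by (rule halts_within_exec) simp_all
  next
    fix s1 assume frame1: "frame ?init s s1" and feasible: "nmem s1 ''feasible'' 0 = 1"
    have "ready s"
      using slots frame by (simp add: ready_def frame_def input_state_def nat_array_def)
    then have ready1: "ready s1"
      by (rule ready_frame[OF _ frame1]) simp_all
    have "mate s1 = (\<lambda>_. 0)" "row_dual s1 = (\<lambda>_. 0)" "col_dual s1 = (\<lambda>_. 0)"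
      using frame frame1 by (simp_all add: frame_def input_state_def)
    then have "matched 0 s1"
      using tight_matching_empty by (simp add: slot_cost_def)
    then show "halts_within (1300 * (num_slots I + 1) ^ 3) (insert_rows ;; write_parents) s1
        (correct_output I)"
    proof (rule halts_within_mono[OF halts_solve[OF ready1] order_refl])
      fix s2 assume "frame (insert_rows ;; write_parents) s1 s2"
        and opt: "optimal_assignment I (nmem s2 ''parent'')"
      then have "nmem s2 ''feasible'' 0 = 1" "nmem s2 ''num_steiner'' 0 = 0"
        using feasible frame frame1 by (simp_all add: frame_def input_state_def)
      then show "correct_output I s2"
        using opt le by (intro correct_outputI[OF inst]) auto
    qed
  qed
qed

lemma halts_hungarian:
  assumes inst: "flamecast_instance I" "exponent I = 1 \<or> num_layers I = 0"
  shows "halts_within (1500 * (num_slots I + 1) ^ 3) hungarian (input_state I) (correct_output I)"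
proof -
  let ?M = "num_slots I + 1" and ?test = "NLess (nreg ''slots'') (nreg ''num_sources'')"
  let ?T = "10 + 1300 * ?M ^ 3"
  have "halts_within (100 * ?M + (btime ?test + ?T + 1)) hungarian (input_state I)
      (correct_output I)"
    unfolding hungarian_def
  proof (rule halts_within_Seq[OF halts_build_slots[OF inst(1)]], rule halts_within_Cond)
    fix s assume frame: "frame build_slots (input_state I) s"
      and slots: "slots_built I (num_slots I) s"
    have test: "bval ?test s \<longleftrightarrow> num_slots I < num_sources I"
      using frame slots by (simp add: frame_def slots_built_def input_state_def nat_array_def)
    show "halts_within ?T Skip s (correct_output I)" if "bval ?test s"
    proof (rule halts_within_exec)
      have "nmem s ''feasible'' 0 = 0"
        using frame by (simp add: frame_def input_state_def)
      then show "correct_output I (exec Skip s)"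
        using that test by (intro correct_outputI[OF inst]) simp_all
    qed simp_all
    show "halts_within ?T (nset ''feasible'' (NConst 1) ;; insert_rows ;; write_parents) s
        (correct_output I)" if "\<not> bval ?test s"
      using that test by (intro halts_hungarian_feasible[OF inst _ frame slots]) simp
  qed
  then show ?thesis
    by (rule halts_within_mono) (simp_all add: power3_eq_cube algebra_simps)
qed

lemma plus_one_power_bigo: "(\<lambda>N. c * (real N + 1) ^ k) \<in> O(\<lambda>N. real N ^ k)"
proof -
  have "(\<lambda>N. real N + 1) \<in> O(real)"
    by (rule bigoI[of _ 2]) (auto intro: eventually_sequentiallyI[of 1])
  then have "(\<lambda>N. (real N + 1) ^ k) \<in> O(\<lambda>N. real N ^ k)"
    by (rule landau_o.big_power)
  then show ?thesis
    by simp
qed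

theorem theorem7:
  "\<exists>(prog :: com) (time :: nat \<Rightarrow> real).
     time \<in> O(\<lambda>N. real N ^ 3) \<and>
     (\<forall>I. flamecast_instance I \<and> (exponent I = 1 \<or> num_layers I = 0) \<longrightarrow>
        (\<exists>t s. runs prog (input_state I) t s \<and>
           real t \<le> time (cap I 0 * num_sinks I) \<and>
           correct_output I s))"
proof (rule exI[of _ hungarian], rule exI[of _ "\<lambda>N. 1500 * (real N + 1) ^ 3"],
    intro conjI allI impI)
  show "(\<lambda>N. 1500 * (real N + 1) ^ 3) \<in> O(\<lambda>N. real N ^ 3)"
    by (rule plus_one_power_bigo)
next
  fix I assume "flamecast_instance I \<and> (exponent I = 1 \<or> num_layers I = 0)"
  then obtain t s where run: "runs hungarian (input_state I) t s" "correct_output I s"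
      and "t \<le> 1500 * (num_slots I + 1) ^ 3"
    using halts_hungarian unfolding halts_within_def by blast
  then have "real t \<le> real (1500 * (num_slots I + 1) ^ 3)"
    by (simp only: of_nat_le_iff)
  also have "\<dots> = 1500 * (real (cap I 0 * num_sinks I) + 1) ^ 3"
    by (simp add: num_slots_def add.commute)
  finally show "\<exists>t s. runs hungarian (input_state I) t s \<and>
      real t \<le> 1500 * (real (cap I 0 * num_sinks I) + 1) ^ 3 \<and> correct_output I s"
    using run by blast
qed

end
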